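(* For $q\in\mathbb{Q}^*\setminus\mathbb{Q}^{*2}$ and $m\in\mathbb{Q}^*$ (taken modulo $\mathbb{Q}^{*2}$, with $m\notin\mathbb{Q}^{*2}$) such that $A:=\frac{1-m}{4q^2}\notin\mathbb{Q}^{*4}$, let $\mathcal{C}_{m,q}$ be the plane quartic $$-qX^4+4qmX^3Y-6qmX^2Y^2+4qm^2XY^3-qm^2Y^4+q(X^2-mY^2)^2+Z^4=0.$$ The family $\{\mathcal{C}_{m,q}\}$ contains infinitely many pairwise non-$\mathbb{Q}$-isomorphic smooth plane quartic curves $C$ over $\mathbb{Q}$ (with $\operatorname{Aut}(C_{\overline{\mathbb{Q}}})\cong\mathrm{GAP}(16,13)$) for which $\Gamma_2(C,\mathbb{Q})$ is finite.
   Context: $\Gamma_2(C,\mathbb{Q})=\bigcup\{C(L'): \mathbb{Q}\subseteq L'\subseteq\overline{\mathbb{Q}},\ [L':\mathbb{Q}]\le2\}$. $\mathrm{GAP}(16,13)$ is SmallGroup$(16,13)$ of the GAP library. The curves $\mathcal{C}_{m,q}$ are non-diagonal twists over $\mathbb{Q}$ of $AX^4+Y^4+Z^4+X^2Y^2=0$ with $A=\frac{1-m}{4q^2}$. *)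

theory Defs
  imports "HOL-Analysis.Analysis" "HOL-Algebra.Group"
begin

text \<open>Ternary forms are represented as functions on complex 3-vectors (points of
  the affine cone over the projective plane over the algebraically closed field C,
  which contains an algebraic closure of Q).\<close>

type_synonym form = "complex^3 \<Rightarrow> complex"

definition Cmq :: "rat \<Rightarrow> rat \<Rightarrow> form" where
  "Cmq m q v = (let X = v$1; Y = v$2; Z = v$3; mm = of_rat m; qq = of_rat q in
     - qq * X^4 + 4 * qq * mm * X^3 * Y - 6 * qq * mm * X^2 * Y^2
     + 4 * qq * mm^2 * X * Y^3 - qq * mm^2 * Y^4
     + qq * (X^2 - mm * Y^2)^2 + Z^4)"

definition partial :: "form \<Rightarrow> 3 \<Rightarrow> complex^3 \<Rightarrow> complex" where
  "partial F i v = deriv (\<lambda>t. F (\<chi> j. if j = i then t else v$j)) (v$i)"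

definition smooth_plane_curve :: "form \<Rightarrow> bool" where
  "smooth_plane_curve F \<longleftrightarrow>
     (\<forall>v. F v = 0 \<and> (\<forall>i. partial F i v = 0) \<longrightarrow> v = 0)"

definition rat_mat_apply :: "rat^3^3 \<Rightarrow> complex^3 \<Rightarrow> complex^3" where
  "rat_mat_apply M v = (\<chi> i. \<Sum>j\<in>UNIV. of_rat (M$i$j) * v$j)"

definition Q_isomorphic :: "form \<Rightarrow> form \<Rightarrow> bool" where
  "Q_isomorphic F G \<longleftrightarrow>
     (\<exists>M::rat^3^3. \<exists>c::complex. invertible M \<and> c \<noteq> 0 \<and>
        (\<forall>v. G (rat_mat_apply M v) = c * F v))"

definition proj_class :: "complex^3 \<Rightarrow> (complex^3) set" where
  "proj_class v = {c *s v | c. c \<noteq> 0}"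

definition mat_class :: "complex^3^3 \<Rightarrow> (complex^3^3) set" where
  "mat_class M = {(\<chi> i j. c * M$i$j) | c. c \<noteq> 0}"

definition Aut_curve :: "form \<Rightarrow> (complex^3^3) set monoid" where
  "Aut_curve F = \<lparr> carrier = {mat_class M | M. invertible M \<and>
                     (\<exists>c. c \<noteq> 0 \<and> (\<forall>v. F (M *v v) = c * F v))},
                   mult = (\<lambda>A B. {P ** Q | P Q. P \<in> A \<and> Q \<in> B}),
                   one = mat_class (mat 1) \<rparr>"

text \<open>GAP SmallGroup(16,13) = the Pauli group, C4 central product D4: elements
  (k,a,b) stand for i^k X^a Z^b with X^2 = Z^2 = 1, ZX = -XZ, i central of order 4.\<close>
definition GAP_16_13 :: "(nat \<times> nat \<times> nat) monoid" where
  "GAP_16_13 = \<lparr> carrier = {(k,a,b). k < 4 \<and> a < 2 \<and> b < 2},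
     mult = (\<lambda>(k1,a1,b1) (k2,a2,b2).
               ((k1 + k2 + 2 * b1 * a2) mod 4, (a1 + a2) mod 2, (b1 + b2) mod 2)),
     one = (0,0,0) \<rparr>"

definition deg_le2_field :: "complex set \<Rightarrow> bool" where
  "deg_le2_field L \<longleftrightarrow>
     1 \<in> L \<and> (\<forall>x\<in>L. \<forall>y\<in>L. x + y \<in> L \<and> x - y \<in> L \<and> x * y \<in> L) \<and>
     (\<forall>x\<in>L. x \<noteq> 0 \<longrightarrow> inverse x \<in> L) \<and>
     (\<exists>a b. L = {of_rat r * a + of_rat s * b | r s. True})"

definition Gamma2 :: "form \<Rightarrow> (complex^3) set set" where
  "Gamma2 F = {proj_class v | v. v \<noteq> 0 \<and> F v = 0 \<and>
                 (\<exists>L. deg_le2_field L \<and> (\<forall>i. v$i \<in> L))}"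

definition admissible :: "rat \<Rightarrow> rat \<Rightarrow> bool" where
  "admissible m q \<longleftrightarrow> q \<noteq> 0 \<and> \<not> (\<exists>r. q = r^2) \<and> m \<noteq> 0 \<and> \<not> (\<exists>r. m = r^2) \<and>
     \<not> (\<exists>r. r \<noteq> 0 \<and> (1 - m) / (4 * q^2) = r^4)"

end

(* Take m = -1 and q = -s^2 with s prime.  The curve becomes
   Z^4 + 4 s^2 f(X, Y) = 0 with f = X Y (X^2 - 2 X Y - Y^2).

   Quadratic points.  Put t = X/Y and w = (Z/Y)^2; then (t, w/(2s)) lies on the elliptic curve
   w^2 = -t (t^2 - 2 t - 1), and a 2-descent shows that (0, 0) is the only affine rational point
   of this curve and of its twist by -1.  If t is rational, the curve or its twist gives t = 0.
   If t is irrational, the rational line through the point and its conjugate meets the cubic in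
   a third rational point, which must be (0, 0); hence t has norm -1 and w = b t, and comparing
   with w = (Z/Y)^2 leaves only Z = 0, because the norm -1 = m of t is not a square.

   Automorphisms and isomorphisms.  A pair of directions in which F = Z^4 + k f is additively
   separable consists, as the catalecticant of f is nonzero, of the Z-direction and a direction
   in the XY-plane.  So every isomorphism is block diagonal, and it remains to find the linear
   similitudes of f.  Up to scalars these form a Klein four-group; modulo the fourth roots of
   unity acting on Z this gives the Pauli group.  A rational isomorphism between the curves of
   parameters s and s' would make s s' a square. *)

theory Submission
  imports Defs "HOL-Computational_Algebra.Nth_Powers" "HOL-Computational_Algebra.Primes"
begin

section \<open>Descent\<close>

lemma coprime_if_no_common_prime_int:
  fixes a b :: int
  assumes "\<And>p. prime p \<Longrightarrow> p dvd a \<Longrightarrow> p dvd b \<Longrightarrow> False" and "a \<noteq> 0 \<or> b \<noteq> 0"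
  shows "coprime a b"
proof (rule ccontr)
  assume "\<not> coprime a b"
  then have "\<not> is_unit (gcd a b)" by (simp add: coprime_iff_gcd_eq_1)
  then obtain p where "prime p" "p dvd gcd a b"
    using prime_divisor_exists[of "gcd a b"] assms(2) by auto
  then show False using assms(1) by auto
qed

lemma coprime_mult_power_nat:
  fixes a b c :: nat
  assumes "a * b = c ^ n" "coprime a b" "n > 0"
  obtains r t where "a = r ^ n" "b = t ^ n" "c = r * t"
proof -
  have "is_nth_power n (a * b)" using assms by auto
  then have "is_nth_power n a" "is_nth_power n b"
    using is_nth_power_mult_coprime_nat_iff[OF assms(2), of n] by auto
  then obtain r t where "a = r ^ n" "b = t ^ n" by (auto elim!: is_nth_powerE)
  moreover from this have "c = r * t"
    using assms by (metis power_mult_distrib power_eq_imp_eq_base zero_le)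
  ultimately show ?thesis using that by blast
qed

lemma coprime_mult_power_int:
  fixes a b c :: int
  assumes "a * b = c ^ n" "coprime a b" "n > 0" "a \<ge> 0" "b \<ge> 0"
  obtains r t where "a = r ^ n" "b = t ^ n" "\<bar>c\<bar> = r * t" "r \<ge> 0" "t \<ge> 0"
proof -
  have "nat a * nat b = nat \<bar>c\<bar> ^ n"
    using assms by (metis abs_ge_zero abs_mult abs_of_nonneg nat_mult_distrib nat_power_eq power_abs)
  moreover have "coprime (nat a) (nat b)"
    using assms by (metis coprime_int_iff int_nat_eq)
  ultimately obtain r t where rt: "nat a = r ^ n" "nat b = t ^ n" "nat \<bar>c\<bar> = r * t"
    using coprime_mult_power_nat \<open>n > 0\<close> by blast
  have "a = int r ^ n" "b = int t ^ n" "\<bar>c\<bar> = int r * int t"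
    using rt assms by (metis int_nat_eq of_nat_power, metis int_nat_eq of_nat_power assms(5),
      metis abs_ge_zero int_nat_eq of_nat_mult)
  then show ?thesis using that[of "int r" "int t"] by auto
qed

text \<open>With A = m^2 + \<epsilon> e^2 one has (A - N)(A + N) = 2 e^4, which splits into fourth
  powers as A = u^4 + 8 v^4 up to sign, with |e| = 2 u v. Hence m^2 = B^2 + 4 v^4 for B = u^2 - 2
  \<epsilon> v^2. Factoring again gives B = r^4 - t^4 with v = r t, which is the original equation
  for r, t, u with the same \<epsilon>.\<close>

lemma quartic_descent_step:
  fixes m e N \<epsilon> :: int
  assumes eq: "m^4 + 2 * \<epsilon> * m^2 * e^2 - e^4 = N^2" and \<epsilon>: "\<epsilon>^2 = 1"
    and cop: "coprime m e" and e: "e \<noteq> 0"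
  obtains r t u where "r^4 + 2 * \<epsilon> * r^2 * t^2 - t^4 = u^2" "coprime r t" "t \<noteq> 0"
    "\<bar>t\<bar> < \<bar>e\<bar>"
proof -
  define A where "A = m^2 + \<epsilon> * e^2"
  have AN: "A^2 - N^2 = 2 * e^4"
    using eq \<epsilon> unfolding A_def by algebra
  have sq4: "x^2 mod 4 = (if even x then 0 else 1)" for x :: int
  proof (cases "even x")
    case True
    then obtain k where "x = 2 * k" by (elim evenE)
    then have "x^2 = 4 * k^2" by (simp add: power_mult_distrib)
    then show ?thesis using True by simp
  next
    case False
    then obtain k where "x = 2 * k + 1" by (elim oddE)
    then have "x^2 = 4 * (k^2 + k) + 1" by algebra
    then show ?thesis using False by presburger
  qed
  \<comment> \<open>For odd e the difference A^2 - N^2 would be 2 mod 4, which no difference of two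
    squares is.\<close>
  have "even e"
  proof (rule ccontr)
    assume "odd e"
    then have "odd (e^4)" by simp
    then obtain k where k: "e^4 = 2*k+1" by (elim oddE)
    have "(A^2 - N^2) mod 4 = 2" unfolding AN k by presburger
    moreover have "(A^2 - N^2) mod 4 = (A^2 mod 4 - N^2 mod 4) mod 4" by (simp add: mod_diff_eq)
    ultimately show False unfolding sq4 by (auto split: if_splits)
  qed
  then obtain f where f: "e = 2 * f" by (auto elim: evenE)
  have "odd m" using cop \<open>even e\<close> by (metis coprime_left_2_iff_odd coprime_divisors dvd_refl)
  then have "odd A" using \<open>even e\<close> by (simp add: A_def)
  have "even (N^2 - A^2)" using AN by presburger
  then have "odd N" using \<open>odd A\<close> by simp
  have "even (A - N)" "even (A + N)" using \<open>odd A\<close> \<open>odd N\<close> by simp_all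
  then obtain a b where ab: "A - N = 2 * a" "A + N = 2 * b" by (elim evenE)
  have A: "A = a + b" and N: "N = b - a" using ab by linarith+
  have prod: "a * b = 8 * f^4"
    using AN unfolding A N f by algebra
  have copAe: "coprime A e"
  proof (rule coprime_if_no_common_prime_int, goal_cases)
    case (1 p)
    have "m^2 = A - e * (\<epsilon> * e)" unfolding A_def by algebra
    then have "p dvd m^2" using 1 by simp
    then have "p dvd m" using 1 prime_dvd_power by blast
    then show ?case using cop 1 by (meson coprime_common_divisor not_prime_unit)
  qed (use e in auto)
  have copab: "coprime a b"
  proof (rule coprime_if_no_common_prime_int, goal_cases)
    case (1 p)
    then have pA: "p dvd A" unfolding A by simp
    have "p dvd 8 * f^4" using 1 prod by (metis dvd_mult2)
    moreover have "e^4 = (8 * f^4) * 2" unfolding f by algebra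
    ultimately have "p dvd e^4" by (metis dvd_mult2)
    then have "p dvd e" using 1 prime_dvd_power by blast
    then show ?case using copAe pA 1 by (meson coprime_common_divisor not_prime_unit)
  qed (use e prod f in auto)
  define \<sigma> where "\<sigma> = sgn A"
  have "A \<noteq> 0" using \<open>odd A\<close> by auto
  then have \<sigma>: "\<sigma>^2 = 1" unfolding \<sigma>_def by (simp add: sgn_if)
  have ab0: "a * b > 0" using prod e f by simp
  define a' b' where "a' = \<sigma> * a" and "b' = \<sigma> * b"
  have pos: "a' > 0" "b' > 0"
    using ab0 A unfolding a'_def b'_def \<sigma>_def by (auto simp: sgn_if zero_less_mult_iff split: if_splits)
  have cop': "coprime a' b'" unfolding a'_def b'_def \<sigma>_def
    using copab \<open>A \<noteq> 0\<close> by (simp add: sgn_if)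
  have prod': "a' * b' = 8 * f^4" unfolding a'_def b'_def using prod \<sigma> by algebra
  have A': "\<sigma> * A = a' + b'" unfolding a'_def b'_def A by (simp add: algebra_simps)
  \<comment> \<open>Exactly one of the two coprime factors is even, and it absorbs the whole of 8; c
    is the odd one.\<close>
  have "\<exists>c d. a' + b' = c + 8 * d \<and> c * d = f^4 \<and> coprime c d \<and> c \<ge> 0 \<and> d \<ge> 0"
  proof -
    have split8: ?thesis if "x * y = 8 * f^4" "coprime x y" "x > 0" "y > 0" "x + y = a' + b'" "even x" for x y
    proof -
      have "odd y" using that(2,6) by (metis coprime_left_2_iff_odd coprime_divisors dvd_refl)
      then have "coprime (2^3) y" by (simp only: coprime_power_left_iff) simp
      then have "coprime 8 y" by simp
      moreover have "8 dvd x * y" using that(1) by simp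
      ultimately have "8 dvd x" by (simp add: coprime_dvd_mult_left_iff)
      then obtain d where "x = 8 * d" by (elim dvdE)
      then show ?thesis using that(1-5)
        by - (rule exI[of _ y], rule exI[of _ d], auto simp: coprime_commute mult.commute)
    qed
    have "even a' \<or> even b'" using prod' by (metis dvd_mult2 even_mult_iff even_numeral)
    then show ?thesis using split8[of a' b'] split8[of b' a'] prod' cop' pos
      by (auto simp: mult.commute add.commute coprime_commute)
  qed
  then obtain c d where cd: "a' + b' = c + 8 * d" "c * d = f^4" "coprime c d" "c \<ge> 0" "d \<ge> 0" by blast
  obtain u v where uv: "c = u^4" "d = v^4" "\<bar>f\<bar> = u * v" "u \<ge> 0" "v \<ge> 0"
    using coprime_mult_power_int[OF cd(2,3) _ cd(4,5)] by auto
  have f2: "f^2 = u^2 * v^2" using uv(3) by (metis power2_abs power_mult_distrib)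
  have \<sigma>A: "\<sigma> * A = u^4 + 8 * v^4" using A' cd uv by simp
  have AA: "A = m^2 + 4 * \<epsilon> * u^2 * v^2" unfolding A_def f using f2 by algebra
  have u0: "u > 0" and v0: "v > 0" using uv e f by (auto simp: zero_less_mult_iff order_less_le)
  \<comment> \<open>A negative A would write 0 as a sum of squares, one of them positive.\<close>
  have "\<sigma> = 1"
  proof (rule ccontr)
    assume "\<sigma> \<noteq> 1"
    then have "\<sigma> = -1" using \<open>A \<noteq> 0\<close> unfolding \<sigma>_def by (simp add: sgn_if split: if_splits)
    then have "m^2 + (u^2 + 2 * \<epsilon> * v^2)^2 + 4 * v^4 = 0"
      using \<sigma>A AA \<epsilon> by algebra
    moreover have "v^4 > 0" using v0 by simp
    ultimately show False by (smt (verit) zero_le_power2)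
  qed
  define B where "B = u^2 - 2 * \<epsilon> * v^2"
  have mB: "m^2 = B^2 + 4 * v^4"
    using \<sigma>A AA \<epsilon> \<open>\<sigma> = 1\<close> unfolding B_def by algebra
  define M where "M = \<bar>m\<bar>"
  have MB: "M^2 = B^2 + 4 * v^4" using mB by (simp add: M_def)
  have "odd M" using \<open>odd m\<close> by (simp add: M_def)
  have "odd (M^2)" using \<open>odd M\<close> by simp
  then have "odd (B^2)" unfolding MB by simp
  then have "odd B" by simp
  have "even (M + B)" "even (M - B)" using \<open>odd M\<close> \<open>odd B\<close> by simp_all
  then obtain g h where gh: "M + B = 2 * g" "M - B = 2 * h" by (elim evenE)
  have M: "M = g + h" and B: "B = g - h" using gh by linarith+
  have ghv: "g * h = v^4" using MB unfolding M B by algebra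
  have "M > 0" using \<open>odd M\<close> unfolding M_def by auto
  have "g > 0" "h > 0"
    using \<open>M > 0\<close> ghv v0 unfolding M by (smt (verit) zero_less_mult_iff zero_less_power)+
  have copuv: "coprime u v" using cd(3) unfolding uv by simp
  have copgh: "coprime g h"
  proof (rule coprime_if_no_common_prime_int, goal_cases)
    case (1 p)
    then have pB: "p dvd B" unfolding B by simp
    have "p dvd v^4" using 1 ghv by (metis dvd_mult2)
    then have pv: "p dvd v" using 1 prime_dvd_power by blast
    have "u^2 = B + v * (2 * \<epsilon> * v)" unfolding B_def by algebra
    then have "p dvd u^2" using pB pv by simp
    then have "p dvd u" using 1 prime_dvd_power by blast
    then show ?case using copuv pv 1 by (meson coprime_common_divisor not_prime_unit)
  qed (use \<open>g > 0\<close> in auto)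
  obtain r t where rt: "g = r^4" "h = t^4" "\<bar>v\<bar> = r * t" "r \<ge> 0" "t \<ge> 0"
    using coprime_mult_power_int[OF ghv copgh] \<open>g > 0\<close> \<open>h > 0\<close> by auto
  have v: "v = r * t" using rt(3) v0 by simp
  have "r > 0" "t > 0" using v v0 rt by (auto simp: order_less_le)
  have "r^4 + 2 * \<epsilon> * r^2 * t^2 - t^4 = u^2"
    using B unfolding B_def v rt by algebra
  moreover have "coprime r t" using copgh unfolding rt by simp
  moreover have "\<bar>t\<bar> < \<bar>e\<bar>"
  proof -
    have "\<bar>e\<bar> = 2 * (u * (r * t))" using f uv(3) v by (simp add: abs_mult)
    moreover have "1 * (1 * t) \<le> u * (r * t)"
      using u0 \<open>r > 0\<close> \<open>t > 0\<close> by (intro mult_mono) auto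
    ultimately show ?thesis using \<open>t > 0\<close> by simp
  qed
  ultimately show ?thesis using that \<open>t > 0\<close> by blast
qed

lemma quartic_square_trivial:
  fixes m e N \<epsilon> :: int
  assumes "m^4 + 2 * \<epsilon> * m^2 * e^2 - e^4 = N^2" and "\<epsilon>^2 = 1" and "coprime m e"
  shows "e = 0"
  using assms
proof (induction "nat \<bar>e\<bar>" arbitrary: m e N rule: less_induct)
  case less
  show ?case
  proof (rule ccontr)
    assume "e \<noteq> 0"
    then obtain r t u where "r^4 + 2 * \<epsilon> * r^2 * t^2 - t^4 = u^2" "coprime r t" "t \<noteq> 0"
      "\<bar>t\<bar> < \<bar>e\<bar>"
      using quartic_descent_step less.prems by metis
    then show False using less.hyps[of t r u] less.prems(2) by auto
  qed
qed

section \<open>Rational points of the elliptic curve and of its twist\<close>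

lemma rat_square_int:
  fixes x :: rat
  assumes "x^2 = of_int k"
  obtains W where "k = W^2"
proof -
  obtain p n where x: "x = of_int p / of_int n" and n: "n > 0" and cop: "coprime p n"
    by (metis quotient_of_denom_pos quotient_of_coprime quotient_of_div surj_pair)
  have "of_int (p^2) = (of_int (k * n^2) :: rat)"
    using assms n unfolding x by (simp add: field_simps)
  then have eq: "p^2 = k * n^2" by (simp only: of_int_eq_iff)
  then have "n^2 dvd p^2" by simp
  then have "n dvd p" by simp
  then have "n = 1" using cop n by (metis coprime_common_divisor dvd_refl zdvd1_eq abs_of_pos)
  then show ?thesis using eq that by auto
qed

text \<open>In lowest terms x = p/n the square n p k has pairwise coprime factors, so each is a
  square up to sign, and p, k have equal signs. Either sign leads to the descent quartic, with m and
  e exchanged when p is negative. For x = -t, \<epsilon> = 1 this is the curve w^2 = -t (t^2 - 2 t -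
  1); for x = t, \<epsilon> = -1 it is the twist by -1.\<close>

lemma rational_points_cubic:
  fixes x w :: rat and \<epsilon> :: int
  assumes eq: "w^2 = x * (x^2 + 2 * of_int \<epsilon> * x - 1)" and \<epsilon>: "\<epsilon>^2 = 1"
  shows "x = 0"
proof (rule ccontr)
  assume "x \<noteq> 0"
  obtain p n where x: "x = of_int p / of_int n" and n: "n > 0" and cop: "coprime p n"
    by (metis quotient_of_denom_pos quotient_of_coprime quotient_of_div surj_pair)
  have "p \<noteq> 0" using \<open>x \<noteq> 0\<close> x by auto
  define k where "k = p^2 + 2 * \<epsilon> * p * n - n^2"
  have xn: "x * of_int n = of_int p" using n x by simp
  \<comment> \<open>Denominators are cleared with n^4 instead of n^3, so that the left side stays a
    square.\<close>
  have "(w * of_int n^2)^2 = of_int (n * p * k)"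
    unfolding k_def of_int_mult of_int_add of_int_diff of_int_power xn[symmetric] of_int_numeral
    using eq by algebra
  then obtain W where W: "n * p * k = W^2" by (rule rat_square_int)
  have "coprime n k"
  proof (rule coprime_if_no_common_prime_int, goal_cases)
    case (1 r)
    have "p^2 = k + n * (n - 2 * \<epsilon> * p)" unfolding k_def by algebra
    then have "r dvd p^2" using 1 by simp
    then have "r dvd p" using 1 prime_dvd_power by blast
    then show ?case using cop 1 by (meson coprime_common_divisor not_prime_unit)
  qed (use n in auto)
  moreover have "coprime p k"
  proof (rule coprime_if_no_common_prime_int, goal_cases)
    case (1 r)
    have "n^2 = p * (p + 2 * \<epsilon> * n) - k" unfolding k_def by algebra
    then have "r dvd n^2" using 1 by simp
    then have "r dvd n" using 1 prime_dvd_power by blast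
    then show ?case using cop 1 by (meson coprime_common_divisor not_prime_unit)
  qed (use \<open>p \<noteq> 0\<close> in auto)
  ultimately have cops: "coprime n (\<bar>p\<bar> * \<bar>k\<bar>)" "coprime \<bar>p\<bar> \<bar>k\<bar>"
    using cop by (simp_all add: coprime_commute)
  have "n * (\<bar>p\<bar> * \<bar>k\<bar>) = W^2"
    using W n by (metis abs_mult abs_of_pos abs_power2 mult.assoc)
  then obtain e d where ed: "n = e^2" "\<bar>p\<bar> * \<bar>k\<bar> = d^2"
    using coprime_mult_power_int[OF _ cops(1)] n by (metis abs_ge_zero less_imp_le mult_nonneg_nonneg pos2)
  obtain m N where mN: "\<bar>p\<bar> = m^2" "\<bar>k\<bar> = N^2"
    using coprime_mult_power_int[OF ed(2) cops(2)] by (metis abs_ge_zero pos2)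
  have "m \<noteq> 0" "e \<noteq> 0" using mN ed n \<open>p \<noteq> 0\<close> by auto
  have "coprime (m^2) (e^2)" using cop mN ed by (metis coprime_abs_left_iff)
  then have cme: "coprime m e" by simp
  have "0 \<le> p * k" using W n by (metis mult.assoc zero_le_mult_iff zero_le_power2 not_less)
  then consider "p = m^2" "k = N^2" | "p = - (m^2)" "k = - (N^2)"
    using mN \<open>p \<noteq> 0\<close> by (fastforce simp: zero_le_mult_iff abs_if split: if_splits)
  then show False
  proof cases
    case 1
    have "m^4 + 2 * \<epsilon> * m^2 * e^2 - e^4 = N^2"
      using 1(2) unfolding k_def 1(1) ed(1) by algebra
    then show False using quartic_square_trivial \<epsilon> cme \<open>e \<noteq> 0\<close> by blast
  next
    case 2
    have "e^4 + 2 * \<epsilon> * e^2 * m^2 - m^4 = N^2"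
      using 2(2) unfolding k_def 2(1) ed(1) by algebra
    then show False using quartic_square_trivial \<epsilon> cme \<open>m \<noteq> 0\<close> coprime_commute by blast
  qed
qed

section \<open>Quadratic points\<close>

text \<open>\<open>deg_le2_field\<close> provides only a spanning pair u, v. As t is irrational, the
  coordinates of 1 and t have nonzero determinant D, and Cramer's rule expresses y through 1 and
  t.\<close>

lemma deg_le2_field_basis:
  assumes L: "deg_le2_field L" and "t \<in> L" "y \<in> L" "t \<notin> \<rat>"
  obtains a b where "y = of_rat a + of_rat b * t"
proof -
  obtain u v where "1 \<in> L" and Luv: "L = {of_rat r * u + of_rat s * v | r s. True}"
    using L unfolding deg_le2_field_def by blast
  then obtain r1 s1 r2 s2 r3 s3 where
    one: "1 = of_rat r1 * u + of_rat s1 * v" and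
    t: "t = of_rat r2 * u + of_rat s2 * v" and
    y: "y = of_rat r3 * u + of_rat s3 * v"
    using assms(2,3) by blast
  define D where "D = r1 * s2 - r2 * s1"
  have D: "(of_rat D :: complex) = of_rat r1 * of_rat s2 - of_rat r2 * of_rat s1"
    by (simp add: D_def of_rat_diff of_rat_mult)
  have "D \<noteq> 0"
  proof
    assume "D = 0"
    then have D0: "of_rat r1 * of_rat s2 - of_rat r2 * of_rat s1 = (0::complex)" using D by simp
    have "of_rat r1 * t = of_rat r2" "of_rat s1 * t = of_rat s2"
      using one t D0 by algebra+
    moreover have "r1 \<noteq> 0 \<or> s1 \<noteq> 0" using one by auto
    ultimately have "t = of_rat (r2 / r1) \<or> t = of_rat (s2 / s1)"
      by (auto simp: of_rat_divide field_simps)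
    then show False using \<open>t \<notin> \<rat>\<close> by auto
  qed
  have "of_rat D * y = (of_rat r3 * of_rat s2 - of_rat s3 * of_rat r2)
          + (of_rat r1 * of_rat s3 - of_rat s1 * of_rat r3) * t"
    using one t y unfolding D by algebra
  then have "y = of_rat ((r3 * s2 - s3 * r2) / D) + of_rat ((r1 * s3 - s1 * r3) / D) * t"
    using \<open>D \<noteq> 0\<close>
    by (simp add: of_rat_divide of_rat_diff of_rat_mult nonzero_eq_divide_eq add_divide_distrib [symmetric] mult.commute[of y])
  then show ?thesis using that by blast
qed

lemma rat_coeffs_eqI:
  fixes t :: complex
  assumes "t \<notin> \<rat>" and eq: "of_rat a + of_rat b * t = of_rat c + of_rat d * t"
  shows "a = c \<and> b = d"
proof (cases "b = d")
  case True
  then show ?thesis using eq by simp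
next
  case False
  have "of_rat (b - d) * t = of_rat (c - a)"
    using eq by (simp add: of_rat_diff algebra_simps)
  then have "t = of_rat ((c - a) / (b - d))"
    using False by (simp add: of_rat_divide field_simps)
  then show ?thesis using \<open>t \<notin> \<rat>\<close> by auto
qed

text \<open>Stated in the chart Y = 1. It confines the quadratic points to the ramification points
  of the projection to (X : Y), which is what finiteness needs.\<close>

lemma quadratic_points_z_eq_zero:
  fixes s :: rat
  assumes L: "deg_le2_field L" and t: "t \<in> L" and z: "z \<in> L" and "s \<noteq> 0"
    and eq: "z^4 + 4 * of_rat s^2 * (t * (t^2 - 2 * t - 1)) = 0"
  shows "z = 0"
proof (rule ccontr)
  assume "z \<noteq> 0"
  then have "t \<noteq> 0" using eq by auto
  define w where "w = z^2"
  have "w \<in> L" using L z unfolding deg_le2_field_def w_def power2_eq_square by blast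
  have w2: "w^2 = - (4 * of_rat s^2 * (t * (t^2 - 2 * t - 1)))"
    using eq unfolding w_def by algebra
  show False
  proof (cases "t \<in> \<rat>")
    case True
    then obtain x where x: "t = of_rat x" by (elim Rats_cases)
    define W where "W = - (4 * s^2 * (x * (x^2 - 2 * x - 1)))"
    have W: "w^2 = of_rat W"
      using w2 unfolding x W_def by (simp add: of_rat_minus of_rat_mult of_rat_diff of_rat_power)
    have "x = 0"
    proof (cases "w \<in> \<rat>")
      case True
      then obtain y where "w = of_rat y" by (elim Rats_cases)
      then have "y^2 = W" using W by (simp flip: of_rat_power)
      then have "(y / (2 * s))^2 = (-x) * ((-x)^2 + 2 * of_int 1 * (-x) - 1)"
        using \<open>s \<noteq> 0\<close> unfolding W_def by (simp add: field_simps power2_eq_square)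
      then show ?thesis using rational_points_cubic[of _ "-x" 1] by simp
    next
      case False
      then obtain a b where ab: "z = of_rat a + of_rat b * w"
        using deg_le2_field_basis[OF L \<open>w \<in> L\<close> z] by blast
      \<comment> \<open>Comparing coefficients of z^2 = w in the basis 1, w gives -W = (a/b)^2,
        hence a rational point on the twist by -1.\<close>
      have "of_rat (a^2 + b^2 * W) + of_rat (2 * a * b) * w = of_rat 0 + of_rat 1 * w"
        unfolding of_rat_add of_rat_mult of_rat_power W[symmetric] of_rat_0 of_rat_1 of_rat_numeral_eq
        using ab w_def by algebra
      then have *: "a^2 + b^2 * W = 0" "2 * a * b = 1"
        using rat_coeffs_eqI[OF False] by blast+
      then have "b \<noteq> 0" by auto
      then have "(a / (b * 2 * s))^2 = x * (x^2 + 2 * of_int (-1) * x - 1)"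
        using \<open>s \<noteq> 0\<close> *(1) unfolding W_def by (simp add: field_simps power2_eq_square)
      then show ?thesis using rational_points_cubic[of _ x "-1"] by simp
    qed
    then show False using \<open>t \<noteq> 0\<close> x by simp
  next
    case False
    have "t^2 \<in> L" using L t unfolding deg_le2_field_def power2_eq_square by blast
    then obtain c d where t2: "t^2 = of_rat c + of_rat d * t"
      using deg_le2_field_basis[OF L t _ False] by blast
    obtain a b where w: "w = of_rat a + of_rat b * t"
      using deg_le2_field_basis[OF L t \<open>w \<in> L\<close> False] by blast
    obtain g h where zgh: "z = of_rat g + of_rat h * t"
      using deg_le2_field_basis[OF L t z False] by blast
    have "c \<noteq> 0"
    proof
      assume "c = 0"
      then have "t = of_rat d" using t2 \<open>t \<noteq> 0\<close> by (simp add: power2_eq_square)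
      then show False using False by simp
    qed
    \<comment> \<open>Both sides of \<open>w2\<close> are reduced with t^2 = c + d t, so that t^3 =
      c d + (c + d^2) t.\<close>
    have "of_rat (a^2 + b^2 * c) + of_rat (2 * a * b + b^2 * d) * t =
        of_rat (- (4 * s^2 * (d * c - 2 * c))) + of_rat (- (4 * s^2 * (c + d^2 - 2 * d - 1))) * t"
      unfolding of_rat_add of_rat_mult of_rat_power of_rat_minus of_rat_diff of_rat_0 of_rat_1 of_rat_numeral_eq
      using w2 t2 w by algebra
    then have r: "a^2 + b^2 * c = - (4 * s^2 * (d * c - 2 * c))"
       "2 * a * b + b^2 * d = - (4 * s^2 * (c + d^2 - 2 * d - 1))"
      using rat_coeffs_eqI[OF False] by blast+
    define e where "e = b^2 - 8 * s^2 + 4 * s^2 * d"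
    \<comment> \<open>The line \<open>w = a + b t\<close> through the point and its conjugate meets the cubic
      again in a rational point, whose abscissa is \<open>- e / (4 s\<^sup>2)\<close>.\<close>
    define x where "x = - e / (4 * s^2)"
    have ex: "e = - 4 * s^2 * x" using \<open>s \<noteq> 0\<close> unfolding x_def by simp
    have "a^2 = - (c * e)" using r(1) unfolding e_def by algebra
    have "(a + b * x)^2 = - (4 * s^2 * (x * (x^2 - 2 * x - 1)))"
      using r ex unfolding e_def by algebra
    then have "((a + b * x) / (2 * s))^2 = (-x) * ((-x)^2 + 2 * of_int 1 * (-x) - 1)"
      using \<open>s \<noteq> 0\<close> by (simp add: field_simps power2_eq_square)
    then have "x = 0" using rational_points_cubic[of _ "-x" 1] by simp
    then have "e = 0" "a = 0" using ex \<open>a^2 = - (c * e)\<close> by auto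
    \<comment> \<open>The norm of t is -c, so it equals -1.\<close>
    have "4 * s^2 * (c - 1) = 0" using r(2) \<open>e = 0\<close> \<open>a = 0\<close> unfolding e_def by algebra
    then have "c = 1" using \<open>s \<noteq> 0\<close> by simp
    have t2': "t^2 = 1 + of_rat d * t" and w': "w = of_rat b * t"
      using t2 w \<open>c = 1\<close> \<open>a = 0\<close> by simp_all
    \<comment> \<open>Since t^2 has constant term 1, z^2 has constant coefficient g^2 + h^2, whereas
      w = b t has none.\<close>
    have "of_rat (g^2 + h^2) + of_rat (2 * g * h + h^2 * d) * t = of_rat 0 + of_rat b * t"
      unfolding of_rat_add of_rat_mult of_rat_power of_rat_0 of_rat_numeral_eq
      using zgh w' t2' w_def by algebra
    then have "g^2 + h^2 = 0" using rat_coeffs_eqI[OF False] by blast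
    then have "g = 0 \<and> h = 0" by (simp add: sum_power2_eq_zero_iff)
    then show False using zgh \<open>z \<noteq> 0\<close> by simp
  qed
qed

section \<open>Isomorphisms\<close>

definition bin_quartic :: "complex \<Rightarrow> complex \<Rightarrow> complex" where
  "bin_quartic x y = x * y * (x^2 - 2 * x * y - y^2)"

text \<open>For nonzero k, a cyclic cover of degree 4 of the projective line, branched over the
  roots of \<open>bin_quartic\<close>.\<close>

definition quartic_cover :: "complex \<Rightarrow> form" where
  "quartic_cover k v = v$3^4 + k * bin_quartic (v$1) (v$2)"

text \<open>The choice q = - s^2 makes the coefficient 4 s^2 a square, so that dividing w by 2 s
  leads to the same elliptic curve for all s.\<close>

lemma Cmq_eq_quartic_cover: "Cmq (-1) (- (s^2)) = quartic_cover (4 * of_rat s^2)"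
  by (rule ext, simp add: Cmq_def quartic_cover_def bin_quartic_def Let_def of_rat_minus of_rat_power)
     algebra

text \<open>Only the bidegrees (1,1), (3,1) and (1,3) in \<open>(s, t)\<close> survive antisymmetrisation in the signs of
  \<open>s\<close> and \<open>t\<close>; the values at \<open>\<plusminus>1\<close> and \<open>\<plusminus>2\<close> isolate the coefficient of \<open>s t\<close>.\<close>

lemma mixed_difference_coeff:
  fixes k a1 a2 a3 b1 b2 b3 x y z :: complex
  defines "F \<equiv> \<lambda>x y z. z^4 + k * bin_quartic x y"
  assumes "\<And>x y z s t. F (x + s * a1 + t * b1) (y + s * a2 + t * b2) (z + s * a3 + t * b3)
     - F (x + s * a1) (y + s * a2) (z + s * a3) - F (x + t * b1) (y + t * b2) (z + t * b3)
     + F x y z = 0"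
  shows "12 * (a3 * b3) * z^2 + k * (a1 * b1 * (6 * x * y - 4 * y^2)
     + (a1 * b2 + a2 * b1) * (3 * x^2 - 8 * x * y - 3 * y^2)
     + a2 * b2 * (- 4 * x^2 - 6 * x * y)) = 0"
  using assms(2)[of x 1 1 y z] assms(2)[of x "-1" 1 y z] assms(2)[of x 1 "-1" y z] assms(2)[of x "-1" "-1" y z]
   assms(2)[of x 2 2 y z] assms(2)[of x "-2" 2 y z] assms(2)[of x 2 "-2" y z] assms(2)[of x "-2" "-2" y z]
  unfolding F_def bin_quartic_def by algebra

text \<open>\<open>mixed_difference_coeff\<close> yields the mixed second derivative along a and b.
  Its part in x, y is linear in a1 b1, a1 b2 + a2 b1 and a2 b2, with the nonzero catalecticant as
  determinant up to a constant, so these three vanish. They are the coefficients of the product of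
  two linear forms, one of which is therefore zero.\<close>

lemma quartic_cover_mixed_difference:
  fixes a b :: "complex^3"
  assumes "k \<noteq> 0"
    and diff: "\<And>v s t. quartic_cover k (v + s *s a + t *s b) - quartic_cover k (v + s *s a)
         - quartic_cover k (v + t *s b) + quartic_cover k v = 0"
  shows "a$3 * b$3 = 0" and "a$1 = 0 \<and> a$2 = 0 \<or> b$1 = 0 \<and> b$2 = 0"
proof -
  have E: "12 * (a$3 * b$3) * z^2 + k * (a$1 * b$1 * (6 * x * y - 4 * y^2)
     + (a$1 * b$2 + a$2 * b$1) * (3 * x^2 - 8 * x * y - 3 * y^2)
     + a$2 * b$2 * (- 4 * x^2 - 6 * x * y)) = 0" for x y z
  proof (rule mixed_difference_coeff)
    fix x y z s t
    show "(z + s * a$3 + t * b$3)^4 + k * bin_quartic (x + s * a$1 + t * b$1) (y + s * a$2 + t * b$2)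
        - ((z + s * a$3)^4 + k * bin_quartic (x + s * a$1) (y + s * a$2))
        - ((z + t * b$3)^4 + k * bin_quartic (x + t * b$1) (y + t * b$2))
        + (z^4 + k * bin_quartic x y) = 0"
      using diff[of "vector [x, y, z]" s t] by (simp add: quartic_cover_def)
  qed
  \<comment> \<open>The variables of \<open>E\<close> are instantiated in order of occurrence, z
    first: here z = 1 and x = y = 0.\<close>
  show "a$3 * b$3 = 0" using E[of 1 0 0] by simp
  have E': "a$1 * b$1 * (6 * x * y - 4 * y^2)
     + (a$1 * b$2 + a$2 * b$1) * (3 * x^2 - 8 * x * y - 3 * y^2)
     + a$2 * b$2 * (- 4 * x^2 - 6 * x * y) = 0" for x y
    using E[of 0 x y] \<open>k \<noteq> 0\<close> by simp
  have 1: "3 * (a$1 * b$2 + a$2 * b$1) - 4 * (a$2 * b$2) = 0"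
    using E'[of 1 0] by (simp add: algebra_simps)
  have 2: "- 4 * (a$1 * b$1) - 3 * (a$1 * b$2 + a$2 * b$1) = 0"
    using E'[of 0 1] by (simp add: algebra_simps)
  have "2 * (a$1 * b$1) - 8 * (a$1 * b$2 + a$2 * b$1) - 10 * (a$2 * b$2) = 0"
    using E'[of 1 1] by (simp add: algebra_simps)
  with 1 2 have "a$1 * b$1 = 0" "a$2 * b$2 = 0" "a$1 * b$2 + a$2 * b$1 = 0" by algebra+
  then show "a$1 = 0 \<and> a$2 = 0 \<or> b$1 = 0 \<and> b$2 = 0" by auto
qed

text \<open>No mixed term in Z and X, Y occurs, so the Z-direction is separable from every direction
  of the XY-plane; isomorphisms carry this property over.\<close>

lemma quartic_cover_split:
  "quartic_cover k (v + s *s axis 3 1) + quartic_cover k (v + t *s (axis 1 x + axis 2 y))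
    = quartic_cover k (v + t *s (axis 1 x + axis 2 y) + s *s axis 3 1) + quartic_cover k v"
  by (simp add: quartic_cover_def axis_def)

lemma quartic_cover_isomorphism_block:
  fixes M :: "complex^3^3"
  assumes M: "invertible M" and "k2 \<noteq> 0"
    and eq: "\<And>v. quartic_cover k2 (M *v v) = c * quartic_cover k1 v"
  shows "M$1$3 = 0" "M$2$3 = 0" "M$3$1 = 0" "M$3$2 = 0" "M$3$3 \<noteq> 0"
    "c = M$3$3^4"
    "\<And>x y. k2 * bin_quartic (M$1$1 * x + M$1$2 * y) (M$2$1 * x + M$2$2 * y) = c * k1 * bin_quartic x y"
proof -
  obtain N where N: "M ** N = mat 1" using M unfolding invertible_def by auto
  \<comment> \<open>Separability of \<open>F\<close> in the Z-direction against the XY-plane is transported by \<open>M\<close>.\<close>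
  have det: "det M \<noteq> 0" using M by (simp add: invertible_det_nz)
  have diff: "quartic_cover k2 (v + s *s (M *v (axis 1 x + axis 2 y)) + t *s (M *v axis 3 1))
       - quartic_cover k2 (v + s *s (M *v (axis 1 x + axis 2 y)))
       - quartic_cover k2 (v + t *s (M *v axis 3 1)) + quartic_cover k2 v = 0" for v s t x y
  proof -
    define u where "u = N *v v"
    have v: "v = M *v u" unfolding u_def by (simp add: matrix_vector_mul_assoc N)
    show ?thesis
      unfolding v vector_scalar_commute[symmetric] matrix_vector_right_distrib[symmetric] eq
      using quartic_cover_split[of k1 u t s x y] by algebra
  qed
  note split = quartic_cover_mixed_difference[OF \<open>k2 \<noteq> 0\<close> diff]
  have cols: "M *v axis 3 1 = (\<chi> i. M$i$3)" "M *v (axis 1 x + axis 2 y) = (\<chi> i. M$i$1 * x + M$i$2 * y)" for x y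
    by (simp_all add: vec_eq_iff matrix_vector_mult_def axis_def sum_3)
  note split' = split[unfolded cols, simplified]
  \<comment> \<open>If the image of the Z-axis had a component in the XY-plane, the first two
    columns would have none, and M would be singular.\<close>
  have c3: "M$1$3 = 0 \<and> M$2$3 = 0"
  proof (rule ccontr)
    assume "\<not> ?thesis"
    then have "M$1$1 = 0" "M$2$1 = 0" "M$1$2 = 0" "M$2$2 = 0"
      using split'(2)[of 1 0] split'(2)[of 0 1] by auto
    then show False using det by (simp add: det_3)
  qed
  then have "M$3$3 \<noteq> 0" using det by (auto simp: det_3)
  then have c12: "M$3$1 = 0" "M$3$2 = 0" using split'(1)[of 1 0] split'(1)[of 0 1] by auto
  show "M$1$3 = 0" "M$2$3 = 0" "M$3$1 = 0" "M$3$2 = 0" "M$3$3 \<noteq> 0"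
    using c3 c12 \<open>M$3$3 \<noteq> 0\<close> by auto
  show "c = M$3$3^4"
    using eq[of "axis 3 1"] c3 unfolding cols by (simp add: quartic_cover_def bin_quartic_def axis_def)
  show "k2 * bin_quartic (M$1$1 * x + M$1$2 * y) (M$2$1 * x + M$2$2 * y) = c * k1 * bin_quartic x y" for x y
    using eq[of "axis 1 x + axis 2 y"] c12 unfolding cols
    by (simp add: quartic_cover_def axis_def)
qed

section \<open>Linear similitudes of the binary quartic\<close>

definition root_slope :: complex where
  "root_slope = of_real (1 + sqrt 2)"

text \<open>Chosen so that the involution exchanging the roots \<open>\<infinity>\<close> and \<open>root_slope\<close> of \<open>bin_quartic\<close> leaves
  that form invariant.\<close>

definition root_scale :: complex where
  "root_scale = of_real (1 / sqrt (1 + (1 + sqrt 2)^2))"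

lemma root_slope_sq: "root_slope^2 = 2 * root_slope + 1"
proof -
  define \<alpha> where "\<alpha> = 1 + sqrt 2"
  have "\<alpha>^2 = 2 * \<alpha> + 1"
    unfolding \<alpha>_def by (simp add: power2_eq_square algebra_simps)
  then have "of_real (\<alpha>^2) = (of_real (2 * \<alpha> + 1) :: complex)" by simp
  then show ?thesis unfolding root_slope_def \<alpha>_def[symmetric] by simp
qed

lemma root_scale_sq: "root_scale^2 * (1 + root_slope^2) = 1"
proof -
  define \<alpha> where "\<alpha> = 1 + sqrt 2"
  define \<kappa> where "\<kappa> = 1 / sqrt (1 + \<alpha>^2)"
  have "0 < 1 + \<alpha>^2" by (simp add: add_pos_nonneg)
  then have "\<kappa>^2 * (1 + \<alpha>^2) = 1"
    by (simp add: \<kappa>_def power_divide)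
  then have "of_real (\<kappa>^2 * (1 + \<alpha>^2)) = (of_real 1 :: complex)" by simp
  then show ?thesis
    unfolding root_slope_def root_scale_def \<alpha>_def[symmetric] \<kappa>_def[symmetric] by simp
qed

lemma root_scale_nonzero: "root_scale \<noteq> 0"
  using root_scale_sq by auto

lemma root_slope_nonzero: "root_slope \<noteq> 0"
  using root_slope_sq by auto

text \<open>With \<alpha> = \<open>root_slope\<close>, the roots of \<open>bin_quartic\<close> in t
  = X/Y are 0, \<infinity>, \<alpha> and -1/\<alpha>. The map t -> -1/t exchanges them in pairs; the
  factor \<i> makes the matrix square to 1.\<close>

lemma bin_quartic_swap: "bin_quartic (\<i> * y) (- \<i> * x) = bin_quartic x y"
proof -
  have "\<i>^2 = -1" by simp
  then show ?thesis unfolding bin_quartic_def by algebra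
qed

text \<open>The map t -> (\<alpha> t + 1)/(t - \<alpha>) with \<alpha> = \<open>root_slope\<close>
  exchanges \<infinity> with \<alpha> and 0 with -1/\<alpha>.\<close>

lemma bin_quartic_reflect:
  "bin_quartic (root_scale * (root_slope * x + y)) (root_scale * (x - root_slope * y)) = bin_quartic x y"
proof -
  \<comment> \<open>The factor \<alpha> clears the denominator in u^2 - 2 u v - v^2 = (u - \<alpha>
    v)(u + v/\<alpha>), whose factors become multiples of y and x.\<close>
  have "root_slope * bin_quartic (root_slope * x + y) (x - root_slope * y)
     = root_slope * ((1 + root_slope^2)^2 * bin_quartic x y)"
    using root_slope_sq unfolding bin_quartic_def by algebra
  then have "bin_quartic (root_slope * x + y) (x - root_slope * y) = (1 + root_slope^2)^2 * bin_quartic x y"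
    using root_slope_nonzero by simp
  moreover have "bin_quartic (root_scale * u) (root_scale * v) = root_scale^4 * bin_quartic u v" for u v
    unfolding bin_quartic_def by algebra
  moreover have "root_scale^4 * (1 + root_slope^2)^2 = 1"
    using root_scale_sq by algebra
  ultimately show ?thesis by (simp flip: mult.assoc)
qed

text \<open>Such a similitude induces an affine map permuting the three finite roots. These are real
  and none is the midpoint of the other two, so the map is the identity; the proof checks this by
  comparing coefficients.\<close>

lemma bin_quartic_similitude_fixing_infinity:
  assumes sim: "\<And>x y. bin_quartic (a * x + b * y) (e * y) = l * bin_quartic x y" and "l \<noteq> 0"
  shows "b = 0 \<and> e = a \<and> l = a^4"
proof -
  have y4: "b * e * (b^2 - 2 * b * e - e^2) = 0"
    using sim[of 0 1] by (simp add: bin_quartic_def)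
  have "(a + b) * e * ((a + b)^2 - 2 * (a + b) * e - e^2) = - 2 * l"
    using sim[of 1 1] by (simp add: bin_quartic_def algebra_simps)
  moreover have "- ((a - b) * e * ((a - b)^2 + 2 * (a - b) * e - e^2)) = - 2 * l"
    using sim[of 1 "-1"] by (simp add: bin_quartic_def algebra_simps)
  moreover have "(a + 2 * b) * (2 * e) * ((a + 2 * b)^2 - 4 * (a + 2 * b) * e - 4 * e^2) = - 14 * l"
    using sim[of 1 2] by (simp add: bin_quartic_def algebra_simps)
  ultimately have x3y: "a^3 * e = l" and x2y2: "a^2 * e * (3 * b - 2 * e) = - 2 * l"
    and xy3: "a * e * (3 * b^2 - 4 * b * e - e^2) = - l"
    using y4 by algebra+
  have "a \<noteq> 0" "e \<noteq> 0" using x3y \<open>l \<noteq> 0\<close> by auto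
  have "a^2 * e * (3 * b - 2 * e + 2 * a) = 0" using x2y2 x3y by algebra
  then have lin: "3 * b - 2 * e + 2 * a = 0" using \<open>a \<noteq> 0\<close> \<open>e \<noteq> 0\<close> by simp
  have "a * e * (3 * b^2 - 4 * b * e - e^2 + a^2) = 0" using xy3 x3y by algebra
  then have quad: "3 * b^2 - 4 * b * e - e^2 + a^2 = 0" using \<open>a \<noteq> 0\<close> \<open>e \<noteq> 0\<close> by simp
  have "b * (b^2 - 2 * b * e - e^2) = 0" using y4 \<open>e \<noteq> 0\<close> by simp
  \<comment> \<open>Eliminating a between \<open>lin\<close> and \<open>quad\<close>. A nonzero b
    would give e = 3 b/4, and then b^2 - 2 b e - e^2 = -17 b^2/16 could not vanish.\<close>
  moreover have "b * (21 * b - 28 * e) = 0" using lin quad by algebra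
  ultimately have "b * b^2 = 0" using \<open>e \<noteq> 0\<close> by algebra
  then have "b = 0" by simp
  then have "e = a" using lin by simp
  then show ?thesis using \<open>b = 0\<close> x3y by (simp add: power_numeral_reduce mult.commute)
qed

text \<open>The four alternatives are \<mu> times 1, U, V and U V, for U the matrix of
  \<open>bin_quartic_swap\<close> and V that of \<open>bin_quartic_reflect\<close>.\<close>

lemma bin_quartic_similitude:
  assumes sim: "\<And>x y. bin_quartic (a * x + b * y) (d * x + e * y) = l * bin_quartic x y" and "l \<noteq> 0"
  obtains \<mu> where "l = \<mu>^4" "a = \<mu>" "b = 0" "d = 0" "e = \<mu>"
  | \<mu> where "l = \<mu>^4" "a = 0" "b = \<mu> * \<i>" "d = - (\<mu> * \<i>)" "e = 0"
  | \<mu> where "l = \<mu>^4" "a = \<mu> * (root_scale * root_slope)" "b = \<mu> * root_scale"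
      "d = \<mu> * root_scale" "e = - (\<mu> * (root_scale * root_slope))"
  | \<mu> where "l = \<mu>^4" "a = \<mu> * (root_scale * \<i>)" "b = - (\<mu> * (root_scale * root_slope * \<i>))"
      "d = - (\<mu> * (root_scale * root_slope * \<i>))" "e = - (\<mu> * (root_scale * \<i>))"
proof -
  have "a * d * (a^2 - 2 * a * d - d^2) = 0"
    using sim[of 1 0] unfolding bin_quartic_def by algebra
  moreover have "root_slope * (a^2 - 2 * a * d - d^2) = (root_slope * a + d) * (a - root_slope * d)"
    using root_slope_sq by algebra
  \<comment> \<open>The first column is a root of the form; the Klein four-group moves that root to \<open>\<infinity>\<close>.\<close>
  ultimately consider "d = 0" | "a = 0" | "a - root_slope * d = 0" | "root_slope * a + d = 0"
    using root_slope_nonzero by auto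
  then show ?thesis
  proof cases
    case 1
    then show ?thesis
      using bin_quartic_similitude_fixing_infinity[of a b e l] sim \<open>l \<noteq> 0\<close> that(1) by auto
  next
    case 2
    have "bin_quartic ((\<i> * d) * x + (\<i> * e) * y) ((- \<i> * b) * y) = l * bin_quartic x y" for x y
      using bin_quartic_swap[of "d * x + e * y" "a * x + b * y"] sim[of x y] 2
      by (simp add: algebra_simps)
    then have *: "\<i> * e = 0 \<and> - \<i> * b = \<i> * d \<and> l = (\<i> * d)^4"
      using bin_quartic_similitude_fixing_infinity \<open>l \<noteq> 0\<close> by blast
    then have "\<i> * b = \<i> * (- d)" by (metis minus_minus mult_minus_right mult_minus_left)
    then have "b = - d" by (metis complex_i_not_zero mult_cancel_left)
    moreover have "e = 0" "l = (\<i> * d)^4" using * by auto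
    ultimately show ?thesis using that(2)[of "\<i> * d"] 2 by (simp add: algebra_simps)
  next
    case 3
    define u where "u = root_scale * (root_slope * a + d)"
    define p where "p = root_scale * (root_slope * b + e)"
    define r where "r = root_scale * (b - root_slope * e)"
    have "bin_quartic (u * x + p * y) (r * y) = l * bin_quartic x y" for x y
    proof -
      have "root_scale * (root_slope * (a * x + b * y) + (d * x + e * y)) = u * x + p * y"
        "root_scale * ((a * x + b * y) - root_slope * (d * x + e * y)) = r * y"
        using 3 unfolding u_def p_def r_def by (simp add: algebra_simps, algebra)
      then show ?thesis using bin_quartic_reflect sim[of x y] by metis
    qed
    then have *: "p = 0" "r = u" "l = u^4"
      using bin_quartic_similitude_fixing_infinity \<open>l \<noteq> 0\<close> by blast+
    have "a = u * (root_scale * root_slope)" "b = u * root_scale"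
      "d = u * root_scale" "e = - (u * (root_scale * root_slope))"
      using 3 *(1,2) u_def p_def r_def root_scale_sq by algebra+
    then show ?thesis using that(3) *(3) by blast
  next
    case 4
    define u where "u = \<i> * (root_scale * (a - root_slope * d))"
    define p where "p = \<i> * (root_scale * (b - root_slope * e))"
    define r where "r = - \<i> * (root_scale * (root_slope * b + e))"
    have "bin_quartic (u * x + p * y) (r * y) = l * bin_quartic x y" for x y
    proof -
      have "\<i> * (root_scale * ((a * x + b * y) - root_slope * (d * x + e * y))) = u * x + p * y"
        "- \<i> * (root_scale * (root_slope * (a * x + b * y) + (d * x + e * y))) = r * y"
        using 4 unfolding u_def p_def r_def by (simp add: algebra_simps, algebra)
      then show ?thesis using bin_quartic_reflect bin_quartic_swap sim[of x y] by metis
    qed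
    then have *: "p = 0" "r = u" "l = u^4"
      using bin_quartic_similitude_fixing_infinity \<open>l \<noteq> 0\<close> by blast+
    have i2: "\<i>^2 = -1" by simp
    \<comment> \<open>The inverse of U V is V U = - U V, so \<mu> is -u here.\<close>
    have "a = - u * (root_scale * \<i>)" "b = - (- u * (root_scale * root_slope * \<i>))"
      "d = - (- u * (root_scale * root_slope * \<i>))" "e = - (- u * (root_scale * \<i>))"
      using 4 *(1,2) u_def p_def r_def root_scale_sq i2 by algebra+
    moreover have "l = (- u)^4" using *(3) by simp
    ultimately show ?thesis using that(4) by blast
  qed
qed

section \<open>The automorphism group\<close>

text \<open>The last entry is normalised to 1, so that a class modulo scalars contains at most one
  such matrix.\<close>

definition block_matrix :: "complex \<Rightarrow> complex \<Rightarrow> complex \<Rightarrow> complex \<Rightarrow> complex^3^3" where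
  "block_matrix a b d e = vector [vector [a, b, 0], vector [d, e, 0], vector [0, 0, 1]]"

text \<open>\<open>(k, a, b)\<close> is mapped to \<open>i\<^sup>k U\<^sup>a V\<^sup>b\<close> on the XY-plane, with \<open>U\<close> the substitution of
  \<open>bin_quartic_swap\<close> and \<open>V\<close> that of \<open>bin_quartic_reflect\<close>; \<open>U\<close> and \<open>V\<close> anticommute.\<close>

fun pauli_matrix :: "nat \<times> nat \<times> nat \<Rightarrow> complex^3^3" where
  "pauli_matrix (k, a, b) = (let u = \<i>^k; \<kappa> = root_scale; \<alpha> = root_slope in
     if a = 0 then
       if b = 0 then block_matrix u 0 0 u
       else block_matrix (u * (\<kappa> * \<alpha>)) (u * \<kappa>) (u * \<kappa>) (- (u * (\<kappa> * \<alpha>)))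
     else
       if b = 0 then block_matrix 0 (u * \<i>) (- (u * \<i>)) 0
       else block_matrix (u * (\<kappa> * \<i>)) (- (u * (\<kappa> * \<alpha> * \<i>)))
         (- (u * (\<kappa> * \<alpha> * \<i>))) (- (u * (\<kappa> * \<i>))))"

lemma block_matrix_nth [simp]:
  "block_matrix a b d e $ 1 $ 1 = a" "block_matrix a b d e $ 1 $ 2 = b" "block_matrix a b d e $ 1 $ 3 = 0"
  "block_matrix a b d e $ 2 $ 1 = d" "block_matrix a b d e $ 2 $ 2 = e" "block_matrix a b d e $ 2 $ 3 = 0"
  "block_matrix a b d e $ 3 $ 1 = 0" "block_matrix a b d e $ 3 $ 2 = 0" "block_matrix a b d e $ 3 $ 3 = 1"
  by (simp_all add: block_matrix_def)

lemma block_matrix_mult: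
  "block_matrix a b d e ** block_matrix a' b' d' e'
    = block_matrix (a * a' + b * d') (a * b' + b * e') (d * a' + e * d') (d * b' + e * e')"
  by (simp add: vec_eq_iff forall_3 matrix_matrix_mult_def sum_3)

lemma block_matrix_eq_iff:
  "block_matrix a b d e = block_matrix a' b' d' e' \<longleftrightarrow> a = a' \<and> b = b' \<and> d = d' \<and> e = e'"
  by (auto simp add: vec_eq_iff forall_3)

lemma imag_power_mod_4: "\<i> ^ (n mod 4) = \<i> ^ n"
proof -
  have "\<i> ^ n = \<i> ^ (4 * (n div 4) + n mod 4)" by simp
  also have "\<dots> = \<i> ^ (n mod 4)" by (simp only: power_add power_mult) simp
  finally show ?thesis by simp
qed

text \<open>The relations U^2 = V^2 = 1 and V U = \<i>^2 U V match the term 2 * b1 * a2 in the group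
  law.\<close>

lemma pauli_matrix_mult:
  assumes "x \<in> carrier GAP_16_13" "y \<in> carrier GAP_16_13"
  shows "pauli_matrix (x \<otimes>\<^bsub>GAP_16_13\<^esub> y) = pauli_matrix x ** pauli_matrix y"
proof -
  obtain k a b where x: "x = (k, a, b)" by (cases x)
  obtain l c d where y: "y = (l, c, d)" by (cases y)
  have ab: "a = 0 \<or> a = 1" "b = 0 \<or> b = 1" "c = 0 \<or> c = 1" "d = 0 \<or> d = 1"
    using assms unfolding x y GAP_16_13_def by auto
  have i2: "\<i> * \<i> = -1" by simp
  have sc: "root_scale * root_scale * (1 + root_slope * root_slope) = 1"
    using root_scale_sq by (simp add: power2_eq_square)
  define u w where "u = \<i> ^ k" and "w = \<i> ^ l"
  let ?r = root_scale and ?\<alpha> = root_slope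
  \<comment> \<open>Entry identities left over from the sixteen cases: \<open>m1\<close> rests on
    the normalisation of \<open>root_scale\<close>, \<open>m2\<close> on \<i>^2 = -1,
    \<open>m3\<close> on both.\<close>
  have m1: "u * w = u * (?r * ?\<alpha>) * (w * (?r * ?\<alpha>)) + u * ?r * (w * ?r)"
    "u * w = u * ?r * (w * ?r) + u * (?r * ?\<alpha>) * (w * (?r * ?\<alpha>))"
    "- (u * w * \<i>) = - (u * (?r * ?\<alpha>) * (w * (?r * ?\<alpha> * \<i>))) - u * ?r * (w * (?r * \<i>))"
    "u * w * \<i> = u * ?r * (w * (?r * \<i>)) + u * (?r * ?\<alpha>) * (w * (?r * ?\<alpha> * \<i>))"
    "u * w * \<i> = u * (?r * \<i>) * (w * ?r) + u * (?r * ?\<alpha> * \<i>) * (w * (?r * ?\<alpha>))"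
    "- (u * w * \<i>) = - (u * (?r * ?\<alpha> * \<i>) * (w * (?r * ?\<alpha>))) - u * (?r * \<i>) * (w * ?r)"
    using sc by algebra+
  have m2: "u * w = - (u * \<i> * (w * \<i>))"
    "u * w * (?r * ?\<alpha>) = - (u * \<i> * (w * (?r * ?\<alpha> * \<i>)))"
    "u * w * ?r = - (u * \<i> * (w * (?r * \<i>)))"
    "- (u * w * (?r * ?\<alpha>)) = u * \<i> * (w * (?r * ?\<alpha> * \<i>))"
    "- (u * w * (?r * ?\<alpha>)) = u * (?r * ?\<alpha> * \<i>) * (w * \<i>)"
    "- (u * w * ?r) = u * (?r * \<i>) * (w * \<i>)"
    "u * w * (?r * ?\<alpha>) = - (u * (?r * ?\<alpha> * \<i>) * (w * \<i>))"
    using i2 by algebra+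
  have m3: "- (u * w) = u * (?r * \<i>) * (w * (?r * \<i>)) + u * (?r * ?\<alpha> * \<i>) * (w * (?r * ?\<alpha> * \<i>))"
    "- (u * w) = u * (?r * ?\<alpha> * \<i>) * (w * (?r * ?\<alpha> * \<i>)) + u * (?r * \<i>) * (w * (?r * \<i>))"
    using i2 sc by algebra+
  show ?thesis
    unfolding x y GAP_16_13_def using ab
    by (elim disjE)
       (simp_all add: block_matrix_mult block_matrix_eq_iff imag_power_mod_4 power_add Let_def
          flip: u_def w_def, (intro conjI m1 m2 m3)+)
qed

lemma mat_class_eqI: "c \<noteq> 0 \<Longrightarrow> N = (\<chi> i j. c * M$i$j) \<Longrightarrow> mat_class N = mat_class M"
proof -
  assume c: "c \<noteq> 0" and N: "N = (\<chi> i j. c * M$i$j)"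
  have "(\<chi> i j. d * M$i$j) \<in> mat_class N" if "d \<noteq> 0" for d
    unfolding mat_class_def N using c that by (auto intro!: exI[of _ "d / c"] simp: vec_eq_iff)
  moreover have "(\<chi> i j. d * N$i$j) \<in> mat_class M" if "d \<noteq> 0" for d
    unfolding mat_class_def N using c that by (auto intro!: exI[of _ "d * c"] simp: vec_eq_iff)
  ultimately show ?thesis by (auto simp: mat_class_def[of M]) (auto simp: mat_class_def[of N])
qed

lemma mat_class_self: "M \<in> mat_class M"
  unfolding mat_class_def by (auto intro!: exI[of _ 1] simp: vec_eq_iff)

text \<open>Identifies the elementwise product of classes in \<open>Aut_curve\<close> with the class
  of the matrix product.\<close>

lemma mat_class_mult: "{P ** Q | P Q. P \<in> mat_class M \<and> Q \<in> mat_class N} = mat_class (M ** N)"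
proof -
  have *: "(\<chi> i j. c * M$i$j) ** (\<chi> i j. d * N$i$j) = (\<chi> i j. (c * d) * (M ** N)$i$j)" for c d
    by (simp add: vec_eq_iff matrix_matrix_mult_def sum_distrib_left mult_ac)
  show ?thesis
  proof (intro equalityI subsetI)
    fix X assume "X \<in> {P ** Q | P Q. P \<in> mat_class M \<and> Q \<in> mat_class N}"
    then obtain c d where "c \<noteq> 0" "d \<noteq> 0" "X = (\<chi> i j. c * M$i$j) ** (\<chi> i j. d * N$i$j)"
      unfolding mat_class_def by auto
    then show "X \<in> mat_class (M ** N)" unfolding * mat_class_def by (auto intro!: exI[of _ "c * d"])
  next
    fix X assume "X \<in> mat_class (M ** N)"
    then obtain c where c: "c \<noteq> 0" and X: "X = (\<chi> i j. c * (M ** N)$i$j)" unfolding mat_class_def by auto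
    have "X = (\<chi> i j. c * M$i$j) ** (\<chi> i j. 1 * N$i$j)" unfolding * X by simp
    moreover have "(\<chi> i j. c * M$i$j) \<in> mat_class M" using c unfolding mat_class_def by auto
    moreover have "(\<chi> i j. 1 * N$i$j) \<in> mat_class N" unfolding mat_class_def by (rule CollectI, rule exI[of _ 1]) simp
    ultimately show "X \<in> {P ** Q | P Q. P \<in> mat_class M \<and> Q \<in> mat_class N}" by blast
  qed
qed

lemma imag_power_lt_4_inject:
  assumes "\<i> ^ k = \<i> ^ l" "k < 4" "l < (4::nat)" shows "k = l"
proof -
  have "k \<in> {0, 1, 2, 3}" "l \<in> {0, 1, 2, 3}" using assms by auto
  then show ?thesis using assms(1)
    by (auto simp: power3_eq_cube complex_eq_iff)
qed

lemma inj_on_pauli_class: "inj_on (\<lambda>x. mat_class (pauli_matrix x)) (carrier GAP_16_13)"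
proof (rule inj_onI)
  fix x y assume xy: "x \<in> carrier GAP_16_13" "y \<in> carrier GAP_16_13"
    and eq: "mat_class (pauli_matrix x) = mat_class (pauli_matrix y)"
  obtain k a b where x: "x = (k, a, b)" by (cases x)
  obtain l c d where y: "y = (l, c, d)" by (cases y)
  have kl: "k < 4" "l < 4" and ab: "a = 0 \<or> a = 1" "b = 0 \<or> b = 1" "c = 0 \<or> c = 1" "d = 0 \<or> d = 1"
    using xy unfolding x y GAP_16_13_def by auto
  have "pauli_matrix x \<in> mat_class (pauli_matrix y)"
    using mat_class_self[of "pauli_matrix x"] eq by simp
  then obtain r where r: "pauli_matrix x = (\<chi> i j. r * pauli_matrix y $ i $ j)"
    unfolding mat_class_def by blast
  have "pauli_matrix x $ 3 $ 3 = r * pauli_matrix y $ 3 $ 3" unfolding r by simp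
  then have "r = 1" unfolding x y by (auto simp: Let_def split: if_splits)
  then have P: "pauli_matrix x = pauli_matrix y" using r by (simp add: vec_eq_iff)
  have kl0: "\<i> ^ k \<noteq> 0" "\<i> ^ l \<noteq> 0" by simp_all
  \<comment> \<open>The zero entries do not tell V from U V; equality of multiples of these would
    force 1 + \<alpha>^2 = 0 for \<alpha> = \<open>root_slope\<close>.\<close>
  have clash: False if "u * root_slope = w * \<i>" "u * root_scale = - (w * (root_scale * root_slope * \<i>))"
    "w \<noteq> 0" for u w
  proof -
    have "root_scale * w * \<i> * (1 + root_slope^2) = 0" using that(1,2) by algebra
    then show False using root_scale_nonzero root_scale_sq that(3) by auto
  qed
  have clash': "\<not> (\<i> ^ k * root_slope = \<i> ^ l * \<i>
      \<and> \<i> ^ k * root_scale = - (\<i> ^ l * (root_scale * root_slope * \<i>)))"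
    "\<not> (\<i> ^ k * \<i> = \<i> ^ l * root_slope
      \<and> - (\<i> ^ k * (root_scale * root_slope * \<i>)) = \<i> ^ l * root_scale)"
    using clash[of "\<i> ^ k" "\<i> ^ l"] clash[of "\<i> ^ l" "\<i> ^ k"] kl0 by metis+
  have "a = c \<and> b = d \<and> \<i> ^ k = \<i> ^ l"
    using P ab root_scale_nonzero root_slope_nonzero unfolding x y
    by (elim disjE; simp add: block_matrix_eq_iff Let_def; use clash' in blast)
  then show "x = y" unfolding x y using imag_power_lt_4_inject kl by blast
qed

lemma det_block_matrix: "det (block_matrix a b d e) = a * e - b * d"
  by (simp add: det_3)

lemma pauli_matrix_automorphism:
  assumes "x \<in> carrier GAP_16_13"
  shows "invertible (pauli_matrix x)" "quartic_cover K (pauli_matrix x *v v) = quartic_cover K v"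
proof -
  obtain k a b where x: "x = (k, a, b)" by (cases x)
  have ab: "a = 0 \<or> a = 1" "b = 0 \<or> b = 1"
    using assms unfolding x GAP_16_13_def by auto
  have sc: "root_scale * root_scale * (1 + root_slope * root_slope) = 1"
    using root_scale_sq by (simp add: power2_eq_square)
  have "(\<i> ^ k)^4 = (\<i>^4)^k" by (simp flip: power_mult add: mult.commute)
  then have u4: "(\<i> ^ k)^4 = 1" by simp
  have scal: "bin_quartic (u * x) (u * y) = u^4 * bin_quartic x y" for u x y
    unfolding bin_quartic_def by algebra
  define u where "u = \<i>^k"
  have u: "u^4 = 1" "u \<noteq> 0" using u4 unfolding u_def by auto
  have app: "quartic_cover K (block_matrix a b d e *v v) = v$3^4 + K * bin_quartic (a * v$1 + b * v$2) (d * v$1 + e * v$2)" for a b d e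
    by (simp add: quartic_cover_def matrix_vector_mult_def sum_3)
  have b: "bin_quartic (u * y) (u * z) = bin_quartic y z" for y z
    using scal[of u y z] u by simp
  have b4: "bin_quartic (u * (root_scale * \<i>) * y - u * (root_scale * root_slope * \<i>) * z)
      (- (u * (root_scale * root_slope * \<i>) * y) - u * (root_scale * \<i>) * z) = bin_quartic y z" for y z
  proof -
    have "u * (root_scale * \<i>) * y - u * (root_scale * root_slope * \<i>) * z
        = u * (\<i> * (root_scale * (y - root_slope * z)))"
      and "- (u * (root_scale * root_slope * \<i>) * y) - u * (root_scale * \<i>) * z
        = u * (- \<i> * (root_scale * (root_slope * y + z)))"
      by (simp_all add: algebra_simps)
    then show ?thesis by (simp only: b bin_quartic_swap bin_quartic_reflect)
  qed
  have "bin_quartic (u * (root_scale * root_slope) * y + u * root_scale * z)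
      (u * root_scale * y - u * (root_scale * root_slope) * z) = bin_quartic y z"
    "bin_quartic (u * \<i> * z) (- (u * \<i> * y)) = bin_quartic y z" for y z
    using b[of "root_scale * (root_slope * y + z)" "root_scale * (y - root_slope * z)"]
      b[of "\<i> * z" "- \<i> * y"]
    unfolding bin_quartic_swap bin_quartic_reflect by (simp_all add: algebra_simps)
  then show "quartic_cover K (pauli_matrix x *v v) = quartic_cover K v"
    using ab by (elim disjE) (simp_all add: x Let_def app u_def[symmetric] b b4, simp_all add: quartic_cover_def)
  have i2: "\<i> * \<i> = -1" by simp
  \<comment> \<open>The determinant is u^2 or -u^2 depending on the case; its square is the same in
    all four.\<close>
  have "(u * u)^2 = u^4" by algebra
  moreover have "(- (u * (root_scale * root_slope) * (u * (root_scale * root_slope)))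
      - u * root_scale * (u * root_scale))^2 = u^4"
    using sc by algebra
  moreover have "(u * \<i> * (u * \<i>))^2 = u^4" using i2 by algebra
  moreover have "(- (u * (root_scale * \<i>) * (u * (root_scale * \<i>)))
      - u * (root_scale * root_slope * \<i>) * (u * (root_scale * root_slope * \<i>)))^2 = u^4"
    using i2 sc by algebra
  ultimately have "det (pauli_matrix x)^2 = u^4"
    using ab by (elim disjE) (simp_all add: x Let_def det_block_matrix flip: u_def)
  then show "invertible (pauli_matrix x)" using u by (auto simp: invertible_det_nz)
qed

lemma fourth_power_eq_imag_power:
  fixes \<mu> \<gamma> :: complex
  assumes "\<mu>^4 = \<gamma>^4" "\<gamma> \<noteq> 0"
  obtains k where "k < 4" "\<mu> = \<gamma> * \<i>^k"
proof -
  have "(\<mu> - \<gamma>) * (\<mu> + \<gamma>) * ((\<mu> - \<i> * \<gamma>) * (\<mu> + \<i> * \<gamma>)) = 0"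
  proof -
    have "(\<mu> - \<i> * \<gamma>) * (\<mu> + \<i> * \<gamma>) = \<mu>^2 + \<gamma>^2" by (simp add: algebra_simps power2_eq_square)
    then show ?thesis using assms(1) by algebra
  qed
  then consider "\<mu> = \<gamma>" | "\<mu> = - \<gamma>" | "\<mu> = \<i> * \<gamma>" | "\<mu> = - (\<i> * \<gamma>)"
    by (auto simp: eq_neg_iff_add_eq_0)
  then show ?thesis
    using that[of 0] that[of 2] that[of 1] that[of 3]
    by cases (auto simp: power3_eq_cube)
qed

text \<open>Z^4 gives c = \<gamma>^4 and the XY-block gives c = \<mu>^4. Hence \<mu>/\<gamma> is a
  fourth root of unity, which becomes the exponent k after division by \<gamma>.\<close>

lemma automorphism_is_pauli:
  fixes M :: "complex^3^3"
  assumes M: "invertible M" and "K \<noteq> 0" "c \<noteq> 0"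
    and eq: "\<And>v. quartic_cover K (M *v v) = c * quartic_cover K v"
  obtains x where "x \<in> carrier GAP_16_13" "mat_class M = mat_class (pauli_matrix x)"
proof -
  note blk = quartic_cover_isomorphism_block[OF M \<open>K \<noteq> 0\<close> eq]
  define \<gamma> where "\<gamma> = M$3$3"
  have "\<gamma> \<noteq> 0" "c = \<gamma>^4" unfolding \<gamma>_def using blk by auto
  have sim: "bin_quartic (M$1$1 * x + M$1$2 * y) (M$2$1 * x + M$2$2 * y) = c * bin_quartic x y" for x y
    using blk(7)[of x y] \<open>K \<noteq> 0\<close> by simp
  have root: "\<exists>k<4. \<mu> = \<gamma> * \<i>^k" if "c = \<mu>^4" for \<mu>
    using fourth_power_eq_imag_power[of \<mu> \<gamma>] that \<open>c = \<gamma>^4\<close> \<open>\<gamma> \<noteq> 0\<close> by metis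
  note result = that
  have conclude: thesis if "k < 4" "a < 2" "b < 2" "M = (\<chi> i j. \<gamma> * pauli_matrix (k, a, b) $ i $ j)" for k a b
    using that(1-3) mat_class_eqI[OF \<open>\<gamma> \<noteq> 0\<close> that(4)]
    by (intro result[of "(k, a, b)"]) (auto simp: GAP_16_13_def)
  show thesis
    using sim \<open>c \<noteq> 0\<close>
  proof (rule bin_quartic_similitude)
    fix \<mu> assume *: "c = \<mu>^4" "M$1$1 = \<mu>" "M$1$2 = 0" "M$2$1 = 0" "M$2$2 = \<mu>"
    obtain k where "k < 4" "\<mu> = \<gamma> * \<i>^k" using root *(1) by blast
    then show thesis using blk(1-4) * by (intro conclude[of k 0 0]) (simp_all add: vec_eq_iff forall_3 \<gamma>_def Let_def)
  next
    fix \<mu> assume *: "c = \<mu>^4" "M$1$1 = 0" "M$1$2 = \<mu> * \<i>" "M$2$1 = - (\<mu> * \<i>)" "M$2$2 = 0"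
    obtain k where "k < 4" "\<mu> = \<gamma> * \<i>^k" using root *(1) by blast
    then show thesis using blk(1-4) * by (intro conclude[of k 1 0]) (simp_all add: vec_eq_iff forall_3 \<gamma>_def Let_def mult.assoc)
  next
    fix \<mu> assume *: "c = \<mu>^4" "M$1$1 = \<mu> * (root_scale * root_slope)" "M$1$2 = \<mu> * root_scale"
      "M$2$1 = \<mu> * root_scale" "M$2$2 = - (\<mu> * (root_scale * root_slope))"
    obtain k where "k < 4" "\<mu> = \<gamma> * \<i>^k" using root *(1) by blast
    then show thesis using blk(1-4) * by (intro conclude[of k 0 1]) (simp_all add: vec_eq_iff forall_3 \<gamma>_def Let_def mult.assoc)
  next
    fix \<mu> assume *: "c = \<mu>^4" "M$1$1 = \<mu> * (root_scale * \<i>)" "M$1$2 = - (\<mu> * (root_scale * root_slope * \<i>))"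
      "M$2$1 = - (\<mu> * (root_scale * root_slope * \<i>))" "M$2$2 = - (\<mu> * (root_scale * \<i>))"
    obtain k where "k < 4" "\<mu> = \<gamma> * \<i>^k" using root *(1) by blast
    then show thesis using blk(1-4) * by (intro conclude[of k 1 1]) (simp_all add: vec_eq_iff forall_3 \<gamma>_def Let_def mult.assoc)
  qed
qed

lemma Aut_quartic_cover_iso:
  assumes "K \<noteq> 0"
  shows "Aut_curve (quartic_cover K) \<cong> GAP_16_13"
proof -
  let ?h = "\<lambda>x. mat_class (pauli_matrix x)" and ?A = "Aut_curve (quartic_cover K)" and ?P = "carrier GAP_16_13"
  have "carrier ?A \<subseteq> ?h ` ?P"
  proof
    fix X assume "X \<in> carrier ?A"
    then obtain M c where X: "X = mat_class M" and M: "invertible M" and c: "c \<noteq> 0"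
      and eq: "\<And>v. quartic_cover K (M *v v) = c * quartic_cover K v"
      unfolding Aut_curve_def by auto
    obtain x where "x \<in> ?P" "mat_class M = ?h x"
      using automorphism_is_pauli[OF M assms c eq] by blast
    then show "X \<in> ?h ` ?P" unfolding X by (intro image_eqI)
  qed
  moreover have "?h x \<in> carrier ?A" if "x \<in> ?P" for x
    using pauli_matrix_automorphism(1)[OF that] pauli_matrix_automorphism(2)[OF that, of K] unfolding Aut_curve_def
    by simp (rule exI[of _ "pauli_matrix x"], simp, rule exI[of _ 1], simp)
  ultimately have img: "?h ` ?P = carrier ?A" by blast
  have bij: "bij_betw ?h ?P (carrier ?A)"
    using inj_on_pauli_class img by (simp add: bij_betw_def)
  have closed: "x \<otimes>\<^bsub>GAP_16_13\<^esub> y \<in> ?P" if "x \<in> ?P" "y \<in> ?P" for x y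
    using that unfolding GAP_16_13_def by auto
  have hom: "?h (x \<otimes>\<^bsub>GAP_16_13\<^esub> y) = ?h x \<otimes>\<^bsub>?A\<^esub> ?h y" if "x \<in> ?P" "y \<in> ?P" for x y
    using that by (simp add: pauli_matrix_mult Aut_curve_def mat_class_mult)
  \<comment> \<open>The isomorphism has to start from \<open>Aut_curve\<close>, so the bijective
    homomorphism \<open>?h\<close> is inverted.\<close>
  define g where "g = inv_into ?P ?h"
  have gbij: "bij_betw g (carrier ?A) ?P" unfolding g_def using bij by (rule bij_betw_inv_into)
  have gh: "g (?h x) = x" if "x \<in> ?P" for x
    unfolding g_def using inj_on_pauli_class that by (rule inv_into_f_f)
  have "g \<in> hom ?A GAP_16_13"
  proof (rule homI)
    fix X assume "X \<in> carrier ?A"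
    then show "g X \<in> ?P" using gbij by (auto simp: bij_betw_def)
  next
    fix X Y assume "X \<in> carrier ?A" "Y \<in> carrier ?A"
    then obtain x y where xy: "x \<in> ?P" "X = ?h x" "y \<in> ?P" "Y = ?h y"
      unfolding img[symmetric] by (elim imageE)
    show "g (X \<otimes>\<^bsub>?A\<^esub> Y) = g X \<otimes>\<^bsub>GAP_16_13\<^esub> g Y"
      unfolding xy hom[OF xy(1,3), symmetric] using gh closed xy by auto
  qed
  then show ?thesis using gbij unfolding is_iso_def iso_def by blast
qed

section \<open>The family\<close>

lemma smooth_quartic_cover:
  assumes "k \<noteq> 0"
  shows "smooth_plane_curve (quartic_cover k)"
  unfolding smooth_plane_curve_def
proof (intro allI impI, elim conjE)
  fix v :: "complex^3"
  assume grad: "\<forall>i. partial (quartic_cover k) i v = 0"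
  define x y z where "x = v$1" and "y = v$2" and "z = v$3"
  have 1: "partial (quartic_cover k) 1 v = k * (3 * x^2 * y - 4 * x * y^2 - y^3)"
    unfolding partial_def quartic_cover_def bin_quartic_def x_def y_def
    by (rule DERIV_imp_deriv)
       (auto intro!: derivative_eq_intros simp: algebra_simps power2_eq_square power3_eq_cube)
  have 2: "partial (quartic_cover k) 2 v = k * (x^3 - 4 * x^2 * y - 3 * x * y^2)"
    unfolding partial_def quartic_cover_def bin_quartic_def x_def y_def
    by (rule DERIV_imp_deriv)
       (auto intro!: derivative_eq_intros simp: algebra_simps power2_eq_square power3_eq_cube)
  have 3: "partial (quartic_cover k) 3 v = 4 * z^3"
    unfolding partial_def quartic_cover_def z_def
    by (rule DERIV_imp_deriv) (auto intro!: derivative_eq_intros)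
  have "z = 0" using 3 grad by simp
  have xy: "3 * x^2 * y - 4 * x * y^2 - y^3 = 0" "x^3 - 4 * x^2 * y - 3 * x * y^2 = 0"
    using 1 2 grad \<open>k \<noteq> 0\<close> by simp_all
  have "x = 0 \<and> y = 0"
  proof (cases "x = 0 \<or> y = 0")
    case True
    then show ?thesis using xy by auto
  next
    case False
    have "y * (3 * x^2 - 4 * x * y - y^2) = 0" "x * (x^2 - 4 * x * y - 3 * y^2) = 0"
      using xy by algebra+
    then have "3 * x^2 - 4 * x * y - y^2 = 0" "x^2 - 4 * x * y - 3 * y^2 = 0"
      using False by simp_all
    \<comment> \<open>Three times the first equation minus the second, and their difference. For
      nonzero x they give x = y and 2 x^2 = 0.\<close>
    then have "x * (x - y) = 0" "x^2 + y^2 = 0" by algebra+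
    then show ?thesis using False by simp
  qed
  then show "v = 0" using \<open>z = 0\<close> unfolding x_def y_def z_def by (simp add: vec_eq_iff forall_3)
qed

lemma proj_class_scale: "c \<noteq> 0 \<Longrightarrow> proj_class (c *s v) = proj_class v"
proof -
  assume c: "c \<noteq> 0"
  have "\<exists>e. d *s v = e *s (c *s v) \<and> e \<noteq> 0" if "d \<noteq> 0" for d
    using c that by (intro exI[of _ "d / c"]) (simp add: vec_eq_iff)
  moreover have "\<exists>e. d *s (c *s v) = e *s v \<and> e \<noteq> 0" if "d \<noteq> 0" for d
    using c that by (intro exI[of _ "d * c"]) (simp add: vec_eq_iff)
  ultimately show ?thesis unfolding proj_class_def by blast
qed

lemma finite_Gamma2_quartic_cover:
  fixes s :: rat
  assumes "s \<noteq> 0"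
  shows "finite (Gamma2 (quartic_cover (4 * of_rat s^2)))"
proof -
  \<comment> \<open>The candidates are the four points of the curve with Z = 0.\<close>
  let ?T = "insert 0 {t. t^2 - 2 * t - 1 = (0::complex)}"
  let ?pts = "insert (proj_class (vector [1, 0, 0])) ((\<lambda>t. proj_class (vector [t, 1, 0])) ` ?T)"
  have "Gamma2 (quartic_cover (4 * of_rat s^2)) \<subseteq> ?pts"
  proof
    fix C assume "C \<in> Gamma2 (quartic_cover (4 * of_rat s^2))"
    then obtain v L where C: "C = proj_class v" and v: "v \<noteq> 0" "quartic_cover (4 * of_rat s^2) v = 0"
      and L: "deg_le2_field L" "\<And>i. v$i \<in> L"
      unfolding Gamma2_def by blast
    show "C \<in> ?pts"
    proof (cases "v$2 = 0")
      case True
      then have "v$3 = 0" using v(2) by (simp add: quartic_cover_def bin_quartic_def)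
      then have "v$1 \<noteq> 0" using v(1) True by (auto simp: vec_eq_iff forall_3)
      then have "proj_class (v$1 *s vector [1, 0, 0]) = proj_class (vector [1, 0, 0])"
        by (rule proj_class_scale)
      moreover have "v$1 *s vector [1, 0, 0] = v"
        using True \<open>v$3 = 0\<close> by (simp add: vec_eq_iff forall_3)
      ultimately have "C = proj_class (vector [1, 0, 0])" unfolding C by simp
      then show ?thesis by simp
    next
      case False
      define t z where "t = v$1 / v$2" and "z = v$3 / v$2"
      have "inverse (v$2) \<in> L" and mult: "\<And>x y. x \<in> L \<Longrightarrow> y \<in> L \<Longrightarrow> x * y \<in> L"
        using L False unfolding deg_le2_field_def by simp_all
      then have "t \<in> L" "z \<in> L"
        unfolding t_def z_def divide_inverse using L(2) by simp_all
      have veq: "v$1 = t * v$2" "v$3 = z * v$2" using False by (simp_all add: t_def z_def)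
      have "v$2^4 * (z^4 + 4 * of_rat s^2 * (t * (t^2 - 2 * t - 1))) = 0"
        using v(2) unfolding quartic_cover_def bin_quartic_def veq by algebra
      then have eq: "z^4 + 4 * of_rat s^2 * (t * (t^2 - 2 * t - 1)) = 0" using False by simp
      have "z = 0"
        by (rule quadratic_points_z_eq_zero[OF L(1) \<open>t \<in> L\<close> \<open>z \<in> L\<close> assms eq])
      then have tT: "t \<in> ?T" using eq assms by auto
      have "v$2 *s vector [t, 1, 0] = v"
        using \<open>z = 0\<close> veq by (simp add: vec_eq_iff forall_3)
      then have Ct: "C = proj_class (vector [t, 1, 0])"
        unfolding C using proj_class_scale[OF False, of "vector [t, 1, 0]"] by simp
      show ?thesis by (rule insertI2, unfold Ct, rule imageI[OF tT])
    qed
  qed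
  moreover have "finite ?T"
  proof -
    have "t = root_slope \<or> t = 2 - root_slope" if "t^2 - 2 * t - 1 = 0" for t
    proof -
      have "(t - root_slope) * (t - (2 - root_slope)) = 0" using that root_slope_sq by algebra
      then show ?thesis by auto
    qed
    then have "?T \<subseteq> {0, root_slope, 2 - root_slope}" by auto
    then show ?thesis by (rule finite_subset) simp
  qed
  then have "finite ?pts" by simp
  ultimately show ?thesis by (rule finite_subset)
qed

section \<open>Rational isomorphisms and admissible parameters\<close>

lemma rat_square_neq_2: "(x::rat)^2 \<noteq> 2"
proof
  assume "x^2 = 2"
  then have "x^2 = of_int 2" by simp
  then obtain W where W: "(2::int) = W^2" by (rule rat_square_int)
  have "\<bar>W\<bar> \<le> 1 \<or> 2 \<le> \<bar>W\<bar>" by linarith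
  then show False
  proof
    assume "\<bar>W\<bar> \<le> 1" then have "W^2 \<le> 1" by (simp add: abs_square_le_1)
    then show False unfolding W[symmetric] by simp
  next
    assume "2 \<le> \<bar>W\<bar>" then have "2^2 \<le> W^2" by (metis abs_le_square_iff abs_numeral)
    then show False unfolding W[symmetric] by simp
  qed
qed

lemma root_slope_irrational: "root_slope \<notin> \<rat>"
proof
  assume "root_slope \<in> \<rat>"
  then obtain r where r: "root_slope = of_rat r" by (elim Rats_cases)
  have "of_rat ((r - 1)^2) = (of_rat 2 :: complex)"
    using root_slope_sq unfolding r of_rat_power of_rat_diff of_rat_1 of_rat_numeral_eq by algebra
  then show False using rat_square_neq_2 by (simp only: of_rat_eq_iff)
qed

lemma of_rat_matrix_invertible:
  fixes M :: "rat^3^3"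
  assumes "invertible M"
  shows "invertible ((\<chi> i j. of_rat (M$i$j)) :: complex^3^3)"
proof -
  have *: "((\<chi> i j. of_rat (A$i$j)) :: complex^3^3) ** (\<chi> i j. of_rat (B$i$j)) = (\<chi> i j. of_rat ((A ** B)$i$j))"
    for A B :: "rat^3^3"
    by (simp add: vec_eq_iff matrix_matrix_mult_def of_rat_sum of_rat_mult)
  have 1: "((\<chi> i j. of_rat ((mat 1 :: rat^3^3)$i$j)) :: complex^3^3) = mat 1"
    by (simp add: vec_eq_iff mat_def)
  obtain N where "M ** N = mat 1" "N ** M = mat 1" using assms unfolding invertible_def by blast
  then show ?thesis unfolding invertible_def by (intro exI[of _ "\<chi> i j. of_rat (N$i$j)"]) (simp add: * 1)
qed

text \<open>The XY-block is a rational similitude with multiplier l = c s^2/t^2. The types V and U V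
  are excluded, as two of their entries have the irrational ratio \<open>root_slope\<close>. For the
  other two types a rational entry has fourth power l, and c is the fourth power of the last
  entry.\<close>

lemma Q_isomorphic_quartic_cover:
  fixes s t :: rat
  assumes "s \<noteq> 0" "t \<noteq> 0"
    and iso: "Q_isomorphic (quartic_cover (4 * of_rat s^2)) (quartic_cover (4 * of_rat t^2))"
  obtains g r where "g \<noteq> 0" "g^4 * s^2 = r^4 * t^2"
proof -
  obtain M c where M: "invertible M" and c: "c \<noteq> 0"
    and eq: "\<And>v. quartic_cover (4 * of_rat t^2) (rat_mat_apply M v) = c * quartic_cover (4 * of_rat s^2) v"
    using iso unfolding Q_isomorphic_def by blast
  define A :: "complex^3^3" where "A = (\<chi> i j. of_rat (M$i$j))"
  have A: "invertible A" unfolding A_def using M by (rule of_rat_matrix_invertible)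
  have "rat_mat_apply M v = A *v v" for v
    by (simp add: A_def rat_mat_apply_def matrix_vector_mult_def)
  then have eqA: "quartic_cover (4 * of_rat t^2) (A *v v) = c * quartic_cover (4 * of_rat s^2) v" for v
    using eq by simp
  have t0: "4 * of_rat t^2 \<noteq> (0::complex)" using \<open>t \<noteq> 0\<close> by simp
  note blk = quartic_cover_isomorphism_block[OF A t0 eqA]
  define l where "l = c * of_rat s^2 / of_rat t^2"
  have "l \<noteq> 0" unfolding l_def using c assms by simp
  have sim: "bin_quartic (A$1$1 * x + A$1$2 * y) (A$2$1 * x + A$2$2 * y) = l * bin_quartic x y" for x y
    using blk(7)[of x y] \<open>t \<noteq> 0\<close> unfolding l_def by (simp add: field_simps)
  have nth: "A$i$j = of_rat (M$i$j)" for i j by (simp add: A_def)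
  have irrational: False if "of_rat a = \<mu> * (root_scale * root_slope)" "of_rat b = \<mu> * root_scale" "\<mu> \<noteq> 0" for a b \<mu>
  proof -
    have "of_rat b \<noteq> (0::complex)" using that root_scale_nonzero by simp
    then have "root_slope = of_rat (a / b)"
      using that by (simp add: of_rat_divide)
    then show False using root_slope_irrational by (metis Rats_of_rat)
  qed
  have "\<exists>r. l = of_rat (r^4)"
    using sim \<open>l \<noteq> 0\<close>
  proof (rule bin_quartic_similitude)
    fix \<mu> assume "l = \<mu>^4" "A$1$1 = \<mu>"
    then show ?thesis by (intro exI[of _ "M$1$1"]) (simp add: nth of_rat_power)
  next
    fix \<mu> assume "l = \<mu>^4" "A$1$2 = \<mu> * \<i>"
    then have "l = (of_rat (M$1$2))^4" by (simp add: nth power_mult_distrib)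
    then show ?thesis by (intro exI[of _ "M$1$2"]) (simp add: of_rat_power)
  next
    fix \<mu> assume "l = \<mu>^4" "A$1$1 = \<mu> * (root_scale * root_slope)" "A$1$2 = \<mu> * root_scale"
    then show ?thesis using irrational[of "M$1$1" \<mu> "M$1$2"] \<open>l \<noteq> 0\<close> by (auto simp: nth)
  next
    fix \<mu> assume "l = \<mu>^4" "A$1$1 = \<mu> * (root_scale * \<i>)" "A$1$2 = - (\<mu> * (root_scale * root_slope * \<i>))"
    then show ?thesis using irrational[of "- M$1$2" "\<mu> * \<i>" "M$1$1"] \<open>l \<noteq> 0\<close>
      by (auto simp: nth of_rat_minus mult_ac)
  qed
  then obtain r where r: "l = of_rat (r^4)" by blast
  have c4: "c = of_rat (M$3$3^4)" using blk(6) by (simp add: nth of_rat_power)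
  have "of_rat (M$3$3^4 * s^2) = (of_rat (r^4 * t^2) :: complex)"
    using r \<open>t \<noteq> 0\<close> unfolding l_def c4 by (simp add: of_rat_mult of_rat_power field_simps)
  then have "M$3$3^4 * s^2 = r^4 * t^2" by (simp only: of_rat_eq_iff)
  moreover have "M$3$3 \<noteq> 0" using blk(5) by (simp add: nth)
  ultimately show ?thesis using that by blast
qed

lemma prime_quartic_covers_not_Q_isomorphic:
  fixes p q :: nat
  assumes "prime p" "prime q" "p \<noteq> q"
  shows "\<not> Q_isomorphic (quartic_cover (4 * of_rat (of_nat p)^2)) (quartic_cover (4 * of_rat (of_nat q)^2))"
proof
  assume iso: "Q_isomorphic (quartic_cover (4 * of_rat (of_nat p)^2)) (quartic_cover (4 * of_rat (of_nat q)^2))"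
  have pq: "p > 0" "q > 0" using assms prime_gt_0_nat by auto
  obtain g r :: rat where g: "g \<noteq> 0" and gr: "g^4 * of_nat p^2 = r^4 * of_nat q^2"
    using Q_isomorphic_quartic_cover[OF _ _ iso] pq by auto
  have "(g^2 * of_nat p)^2 = (r^2 * of_nat q)^2" using gr by (simp add: power_mult_distrib flip: power_mult)
  then have "g^2 * of_nat p = r^2 * of_nat q" by (rule power2_eq_imp_eq) auto
  \<comment> \<open>By g^2 p = r^2 q, the square of r q/g equals p q, which is no square for
    distinct primes.\<close>
  then have "(r * of_nat q / g)^2 = of_int (int (p * q))"
    using g by (simp add: field_simps power2_eq_square)
  then obtain W where W: "int (p * q) = W^2" by (rule rat_square_int)
  have "int p dvd W^2" unfolding W[symmetric] by simp
  then have "int p dvd W" using assms(1) by (metis prime_dvd_power prime_int_nat_transfer prime_nat_int_transfer)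
  then have "int p^2 dvd int (p * q)" unfolding W by (rule dvd_power_same)
  then have "int p dvd int q" using pq by (simp add: power2_eq_square)
  then have "p dvd q" by simp
  then show False using assms primes_dvd_imp_eq by blast
qed

text \<open>Both parameters are negative, hence not squares. Here A = 1/(2 s^4), and A = r^4 would
  make 2 the square of 1/(r s)^2.\<close>

lemma admissible_minus_one:
  assumes "s \<noteq> 0"
  shows "admissible (-1) (- (s^2))"
proof -
  have "- (s^2) \<noteq> r^2" for r
  proof -
    have "s^2 > 0" using assms by simp
    then show ?thesis using zero_le_power2[of r] by linarith
  qed
  moreover have "(-1::rat) \<noteq> r^2" for r using zero_le_power2[of r] by linarith
  moreover have "(1 - (-1)) / (4 * (- (s^2))^2) \<noteq> r^4" if "r \<noteq> 0" for r
  proof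
    assume "(1 - (-1)) / (4 * (- (s^2))^2) = r^4"
    then have "(1 / (r * s)^2)^2 = 2"
      using assms that by (simp add: field_simps power2_eq_square power4_eq_xxxx)
    then show False using rat_square_neq_2 by blast
  qed
  ultimately show ?thesis using assms unfolding admissible_def by auto
qed

theorem mainTheorem17:
  shows "\<exists>S :: (rat \<times> rat) set. infinite S \<and>
     (\<forall>(m,q)\<in>S. admissible m q \<and> smooth_plane_curve (Cmq m q) \<and>
        Aut_curve (Cmq m q) \<cong> GAP_16_13 \<and> finite (Gamma2 (Cmq m q))) \<and>
     (\<forall>(m,q)\<in>S. \<forall>(m',q')\<in>S. (m,q) \<noteq> (m',q') \<longrightarrow>
        \<not> Q_isomorphic (Cmq m q) (Cmq m' q'))"
proof -
  define S :: "(rat \<times> rat) set" where "S = (\<lambda>p. (-1, - (of_nat p^2))) ` {p::nat. prime p}"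
  have "inj_on (\<lambda>p. (-1, - (of_nat p^2)) :: rat \<times> rat) {p::nat. prime p}"
    by (auto simp: inj_on_def simp flip: of_nat_power)
  then have "infinite S" unfolding S_def using primes_infinite by (simp add: finite_image_iff)
  moreover have "admissible m q \<and> smooth_plane_curve (Cmq m q) \<and>
        Aut_curve (Cmq m q) \<cong> GAP_16_13 \<and> finite (Gamma2 (Cmq m q))" if "(m, q) \<in> S" for m q
  proof -
    from that obtain p :: nat where "(m, q) = (-1, - (of_nat p^2))" "p \<in> {p. prime p}"
      unfolding S_def by (elim imageE)
    then have "prime p" and mq: "m = -1" "q = - (of_nat p^2)" by simp_all
    then have p: "(of_nat p :: rat) \<noteq> 0" using prime_gt_0_nat by auto
    then show ?thesis unfolding mq Cmq_eq_quartic_cover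
      by (simp add: admissible_minus_one smooth_quartic_cover Aut_quartic_cover_iso finite_Gamma2_quartic_cover
          del: of_rat_of_nat_eq)
  qed
  moreover have "\<not> Q_isomorphic (Cmq m q) (Cmq m' q')" if "(m, q) \<in> S" "(m', q') \<in> S" "(m, q) \<noteq> (m', q')" for m q m' q'
  proof -
    from that(1,2) obtain p p' :: nat where pp: "p \<in> {p. prime p}" "p' \<in> {p. prime p}"
      and "(m, q) = (-1, - (of_nat p^2))" "(m', q') = (-1, - (of_nat p'^2))"
      unfolding S_def by (elim imageE)
    then have mq: "m = -1" "q = - (of_nat p^2)" "m' = -1" "q' = - (of_nat p'^2)" by simp_all
    then have "p \<noteq> p'" using that(3) by auto
    then show ?thesis
      unfolding mq Cmq_eq_quartic_cover using prime_quartic_covers_not_Q_isomorphic pp by blast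
  qed
  ultimately show ?thesis by (intro exI[of _ S]) blast
qed

end
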